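(* Let $G$ be an active graph with $\deg(G)=3$. 1. If $G$ is decomposable, then $G$ is isomorphic to one of $$P_4\circ D_{2,1},\quad D_{2,1}\circ P_4,\quad P_4\circ\overline{D_{2,1}},\quad \overline{D_{2,1}}\circ P_4,\quad P_4^3,\quad P_4\circ C_4,\quad P_4\circ 2K_2.$$ 2. If $G$ is indecomposable, then $G$ is isomorphic to one of $$T_{111},\quad \overline{T_{111}},\quad D_{3,1},\quad \overline{D_{3,1}},\quad T_{221},\quad \overline{T_{221}},$$ all of which are split graphs.
   Context: Graphs are finite and simple, with nonempty vertex set; $\overline{G}$ is the complement of $G$. A 2-switch on $G$: given four distinct vertices $a,b,x,y$ with $ab,xy\in E(G)$ and $ax,by\notin E(G)$, delete the edges $ab,xy$ and add the edges $ax,by$ (two 2-switches are equal iff they delete the same two edges and add the same two edges). The 2-switch-degree $\deg(G)$ is the number of distinct 2-switches that can be performed on $G$. A vertex is active in $G$ if it is one of the four vertices involved in some 2-switch on $G$; $G$ is active if all its vertices are active. A split graph is a graph whose vertex set can be partitioned into a clique $K$ and an independent set $I$ (either possibly empty); when such a bipartition $(K,I)$ is fixed one writes $(S,K,I)$. An active split graph has a unique bipartition; if it is $(K,I)$, then that of the complement is $(I,K)$. If $(S,K,I)$ is split and $G$ is a graph vertex-disjoint from $S$, the Tyshkevich composition $(S,K,I)\circ G$ has vertex set $V(S)\cup V(G)$ and edge set $E(S)\cup E(G)\cup\{xy: x\in K,\ y\in V(G)\}$. This operation is associative, with the composition of two split graphs carrying the bipartition formed by the unions of cliques and of independent sets.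 A graph $G$ is decomposable if $G=S\circ H$ for some $S,H$ with $|S|,|H|\ge 1$, and indecomposable otherwise. Compositions of named graphs are taken over disjoint copies, and $P_4^3=P_4\circ P_4\circ P_4$ (for $P_4$: $K$ = the two inner vertices, $I$ = the two ends). The named graphs (each split, given by clique $K$, independent set $I$, and neighborhoods of the vertices of $I$): - $D_{2,1}$: $K=\{1,2,3\}$, $I=\{a,b\}$, $N_a=\{1\}$, $N_b=\{2,3\}$. - $D_{3,1}$: $K=\{1,2,3,4\}$, $I=\{a,b\}$, $N_a=\{1\}$, $N_b=\{2,3,4\}$. - $T_{111}$: $K=\{1,2,3\}$, $I=\{a,b,c\}$, $N_a=\{1\}$, $N_b=\{2\}$, $N_c=\{3\}$. - $T_{221}$: $K=\{1,2,3\}$, $I=\{a,b,c\}$, $N_a=\{2\}$, $N_b=\{1,3\}$, $N_c=\{2,3\}$. *)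

theory Defs
  imports Main
begin

record 'a graph =
  verts :: "'a set"
  edges :: "'a set set"

definition simple_graph :: "'a graph \<Rightarrow> bool" where
  "simple_graph G \<longleftrightarrow> finite (verts G) \<and> verts G \<noteq> {} \<and>
     edges G \<subseteq> {{u, v} | u v. u \<in> verts G \<and> v \<in> verts G \<and> u \<noteq> v}"

definition complement :: "'a graph \<Rightarrow> 'a graph" where
  "complement G = \<lparr>verts = verts G,
     edges = {{u, v} | u v. u \<in> verts G \<and> v \<in> verts G \<and> u \<noteq> v \<and> {u, v} \<notin> edges G}\<rparr>"

definition map_graph :: "('a \<Rightarrow> 'b) \<Rightarrow> 'a graph \<Rightarrow> 'b graph" where
  "map_graph f G = \<lparr>verts = f ` verts G, edges = (\<lambda>e. f ` e) ` edges G\<rparr>"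

definition graph_iso :: "'a graph \<Rightarrow> 'b graph \<Rightarrow> bool"  (infix "\<cong>" 50) where
  "G \<cong> H \<longleftrightarrow> (\<exists>f. bij_betw f (verts G) (verts H) \<and>
     (\<forall>u \<in> verts G. \<forall>v \<in> verts G. {u, v} \<in> edges G \<longleftrightarrow> {f u, f v} \<in> edges H))"


definition switchable :: "'a graph \<Rightarrow> 'a \<Rightarrow> 'a \<Rightarrow> 'a \<Rightarrow> 'a \<Rightarrow> bool" where
  "switchable G a b x y \<longleftrightarrow> distinct [a, b, x, y] \<and>
     {a, b} \<in> edges G \<and> {x, y} \<in> edges G \<and> {a, x} \<notin> edges G \<and> {b, y} \<notin> edges G"

text \<open>A 2-switch is identified with the pair (deleted edges, added edges), so that different
  quadruples describing the same 2-switch are counted once.\<close>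

definition two_switches :: "'a graph \<Rightarrow> ('a set set \<times> 'a set set) set" where
  "two_switches G = {({{a, b}, {x, y}}, {{a, x}, {b, y}}) | a b x y. switchable G a b x y}"

definition switch_degree :: "'a graph \<Rightarrow> nat" where
  "switch_degree G = card (two_switches G)"

definition active_vertex :: "'a graph \<Rightarrow> 'a \<Rightarrow> bool" where
  "active_vertex G v \<longleftrightarrow> (\<exists>a b x y. switchable G a b x y \<and> v \<in> {a, b, x, y})"

definition active :: "'a graph \<Rightarrow> bool" where
  "active G \<longleftrightarrow> (\<forall>v \<in> verts G. active_vertex G v)"


definition split_bipartition :: "'a graph \<Rightarrow> 'a set \<Rightarrow> 'a set \<Rightarrow> bool" where
  "split_bipartition G K I \<longleftrightarrow> K \<union> I = verts G \<and> K \<inter> I = {} \<and>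
     (\<forall>u \<in> K. \<forall>v \<in> K. u \<noteq> v \<longrightarrow> {u, v} \<in> edges G) \<and>
     (\<forall>u \<in> I. \<forall>v \<in> I. {u, v} \<notin> edges G)"

definition is_split :: "'a graph \<Rightarrow> bool" where
  "is_split G \<longleftrightarrow> (\<exists>K I. split_bipartition G K I)"

record 'a split_triple =
  graph_of :: "'a graph"
  clique :: "'a set"
  indep :: "'a set"

definition split_triple :: "'a split_triple \<Rightarrow> bool" where
  "split_triple S \<longleftrightarrow> simple_graph (graph_of S) \<and>
     split_bipartition (graph_of S) (clique S) (indep S)"

definition complement_split :: "'a split_triple \<Rightarrow> 'a split_triple" where
  "complement_split S =
     \<lparr>graph_of = complement (graph_of S), clique = indep S, indep = clique S\<rparr>"

definition map_split :: "('a \<Rightarrow> 'b) \<Rightarrow> 'a split_triple \<Rightarrow> 'b split_triple" where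
  "map_split f S = \<lparr>graph_of = map_graph f (graph_of S), clique = f ` clique S, indep = f ` indep S\<rparr>"

text \<open>Meaningful only for vertex-disjoint operands.\<close>

definition tyshkevich :: "'a split_triple \<Rightarrow> 'a graph \<Rightarrow> 'a graph" where
  "tyshkevich S G = \<lparr>verts = verts (graph_of S) \<union> verts G,
     edges = edges (graph_of S) \<union> edges G \<union> {{x, y} | x y. x \<in> clique S \<and> y \<in> verts G}\<rparr>"

definition decomposable :: "'a graph \<Rightarrow> bool" where
  "decomposable G \<longleftrightarrow> (\<exists>S H. split_triple S \<and> simple_graph H \<and>
     verts (graph_of S) \<inter> verts H = {} \<and> G = tyshkevich S H)"

text \<open>Composition of disjoint copies.  The right operand is a plain graph, so iterated compositions
  are nested to the right; by associativity this fixes the meaning of the unbracketed ones.\<close>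

definition compose :: "'a split_triple \<Rightarrow> 'b graph \<Rightarrow> ('a + 'b) graph"  (infixr "\<odot>" 65) where
  "S \<odot> G = tyshkevich (map_split Inl S) (map_graph Inr G)"


text \<open>Assumes \<open>N i \<subseteq> K\<close>; the disjoint sum keeps the vertices of K and I apart.\<close>

definition split_from :: "'k set \<Rightarrow> 'i set \<Rightarrow> ('i \<Rightarrow> 'k set) \<Rightarrow> ('k + 'i) split_triple" where
  "split_from K I N =
     \<lparr>graph_of = \<lparr>verts = Inl ` K \<union> Inr ` I,
        edges = {{Inl u, Inl v} | u v. u \<in> K \<and> v \<in> K \<and> u \<noteq> v}
              \<union> {{Inr i, Inl k} | i k. i \<in> I \<and> k \<in> N i}\<rparr>,
      clique = Inl ` K, indep = Inr ` I\<rparr>"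

definition D21 :: "(nat + char) split_triple" where
  "D21 = split_from {1, 2, 3} {CHR ''a'', CHR ''b''}
     ((\<lambda>_. {})(CHR ''a'' := {1}, CHR ''b'' := {2, 3}))"

definition D31 :: "(nat + char) split_triple" where
  "D31 = split_from {1, 2, 3, 4} {CHR ''a'', CHR ''b''}
     ((\<lambda>_. {})(CHR ''a'' := {1}, CHR ''b'' := {2, 3, 4}))"

definition T111 :: "(nat + char) split_triple" where
  "T111 = split_from {1, 2, 3} {CHR ''a'', CHR ''b'', CHR ''c''}
     ((\<lambda>_. {})(CHR ''a'' := {1}, CHR ''b'' := {2}, CHR ''c'' := {3}))"

definition T221 :: "(nat + char) split_triple" where
  "T221 = split_from {1, 2, 3} {CHR ''a'', CHR ''b'', CHR ''c''}
     ((\<lambda>_. {})(CHR ''a'' := {2}, CHR ''b'' := {1, 3}, CHR ''c'' := {2, 3}))"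

definition P4 :: "nat split_triple" where
  "P4 = \<lparr>graph_of = \<lparr>verts = {0, 1, 2, 3}, edges = {{0, 1}, {1, 2}, {2, 3}}\<rparr>,
         clique = {1, 2}, indep = {0, 3}\<rparr>"

definition C4 :: "nat graph" where
  "C4 = \<lparr>verts = {0, 1, 2, 3}, edges = {{0, 1}, {1, 2}, {2, 3}, {3, 0}}\<rparr>"

definition two_K2 :: "nat graph" where
  "two_K2 = \<lparr>verts = {0, 1, 2, 3}, edges = {{0, 1}, {2, 3}}\<rparr>"

end

theory Submission
  imports Defs
begin

text \<open>A 2-switch lives on an alternating 4-cycle \<open>a b y x\<close>: edges \<open>ab\<close> and \<open>xy\<close>, non-edges \<open>ax\<close> and
\<open>by\<close>. The two remaining pairs decide what the four vertices induce: a path \<open>P\<^sub>4\<close>, which carries one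
switch, or \<open>C\<^sub>4\<close> or \<open>2K\<^sub>2\<close>, which carry two. Complementation exchanges deleted and added edges, so it
preserves the switch degree and activity, and it preserves decomposability; this halves all case
distinctions.

With at most three switches, a vertex outside such a four-set can attach to it in very few ways,
because most ways create new alternating 4-cycles (\<open>path4_end_neighbour\<close>, \<open>two_edges_uniform\<close>).
Either all outside vertices are uniform, that is, each sees everything, or exactly the clique part,
or nothing; or five vertices induce \<open>D\<^sub>2\<^sub>1\<close> or its complement. The same happens one step further:
around a \<open>D\<^sub>2\<^sub>1\<close>, a vertex that is not uniform yields \<open>D\<^sub>3\<^sub>1\<close>, \<open>T\<^sub>2\<^sub>2\<^sub>1\<close> or the complement of
\<open>T\<^sub>2\<^sub>2\<^sub>1\<close>. Uniform vertices force a decomposition (\<open>decomposable_of_uniform\<close>), unless two of them are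
related in the wrong way; around a path this gives \<open>T\<^sub>1\<^sub>1\<^sub>1\<close>, its complement or too many
switches, around \<open>D\<^sub>2\<^sub>1\<close> or \<open>2K\<^sub>2\<close> always too many. So an indecomposable graph of switch degree three
contains one of the six listed graphs. Each of them already carries three switches, and an active
graph consists of the vertices of its switches, so the graph is equal to that six-vertex piece
(\<open>classify_degree_3\<close>).

If the graph is decomposable, every switch lies inside one factor (\<open>decomposition_switchable\<close>).
Both factors are active and nonempty, so their degrees are one and two. The factor of degree one
is \<open>P\<^sub>4\<close>; the method above shows that the factor of degree two is \<open>C\<^sub>4\<close>, \<open>2K\<^sub>2\<close>, \<open>D\<^sub>2\<^sub>1\<close>, the
complement of \<open>D\<^sub>2\<^sub>1\<close>, or again decomposable into two copies of \<open>P\<^sub>4\<close>. The left factor is split, which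
excludes \<open>C\<^sub>4\<close> and \<open>2K\<^sub>2\<close> there, and its bipartition is determined by the graph, so the isomorphisms of
the factors respect cliques and can be glued (\<open>compose_iso\<close>).\<close>

section \<open>Adjacency, switches and complements\<close>

definition adj :: "'a graph \<Rightarrow> 'a \<Rightarrow> 'a \<Rightarrow> bool" where
  "adj G u v \<longleftrightarrow> {u, v} \<in> edges G"

definition switch :: "'a \<Rightarrow> 'a \<Rightarrow> 'a \<Rightarrow> 'a \<Rightarrow> 'a set set \<times> 'a set set" where
  "switch a b x y = ({{a, b}, {x, y}}, {{a, x}, {b, y}})"

definition induced :: "'a graph \<Rightarrow> 'a set \<Rightarrow> 'a graph" where
  "induced G X = \<lparr>verts = X, edges = {e \<in> edges G. e \<subseteq> X}\<rparr>"

lemma adj_commute: "adj G u v = adj G v u"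
  by (simp add: adj_def insert_commute)

lemma adjD:
  assumes "simple_graph G" "adj G u v"
  shows "u \<in> verts G" "v \<in> verts G" "u \<noteq> v"
  using assms unfolding simple_graph_def adj_def
  by (force simp: doubleton_eq_iff)+

lemma adj_irrefl: "simple_graph G \<Longrightarrow> \<not> adj G u u"
  using adjD(3) by metis

lemma switchable_iff:
  "switchable G a b x y \<longleftrightarrow> distinct [a, b, x, y] \<and>
     adj G a b \<and> adj G x y \<and> \<not> adj G a x \<and> \<not> adj G b y"
  by (simp add: switchable_def adj_def)

lemma two_switches_eq: "two_switches G = {switch a b x y | a b x y. switchable G a b x y}"
  by (simp add: two_switches_def switch_def)

lemma switch_in_two_switches: "switchable G a b x y \<Longrightarrow> switch a b x y \<in> two_switches G"
  by (auto simp: two_switches_eq)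

lemma switchable_verts:
  assumes "simple_graph G" "switchable G a b x y"
  shows "{a, b, x, y} \<subseteq> verts G"
  using assms adjD[OF assms(1)] by (auto simp: switchable_iff)

lemma switch_support: "\<Union> (fst (switch a b x y)) = {a, b, x, y}"
  by (auto simp: switch_def)

lemma finite_two_switches:
  assumes "simple_graph G"
  shows "finite (two_switches G)"
proof (rule finite_subset)
  show "two_switches G \<subseteq> Pow (Pow (verts G)) \<times> Pow (Pow (verts G))"
  proof
    fix s assume "s \<in> two_switches G"
    then obtain a b x y where "s = switch a b x y" "switchable G a b x y"
      by (auto simp: two_switches_eq)
    with switchable_verts[OF assms, of a b x y] show "s \<in> Pow (Pow (verts G)) \<times> Pow (Pow (verts G))"
      by (simp add: switch_def)
  qed
  show "finite (Pow (Pow (verts G)) \<times> Pow (Pow (verts G)))"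
    using assms by (simp add: simple_graph_def)
qed

lemma length_switches_le:
  assumes "simple_graph G" "set ss \<subseteq> two_switches G" "distinct ss"
  shows "length ss \<le> switch_degree G"
  using card_mono[OF finite_two_switches[OF assms(1)] assms(2)] distinct_card[OF assms(3)]
  by (simp add: switch_degree_def)

text \<open>The contradiction that drives the local analysis: whenever a configuration is to be excluded, four
pairwise different switches are exhibited.\<close>

lemma not_four_switches:
  assumes "simple_graph G" "switch_degree G \<le> 3"
    and "switchable G a b x y" "switchable G a' b' x' y'"
    and "switchable G a'' b'' x'' y''" "switchable G a''' b''' x''' y'''"
  shows "\<not> distinct [switch a b x y, switch a' b' x' y', switch a'' b'' x'' y'',
            switch a''' b''' x''' y''']"
  using length_switches_le[OF assms(1), of "[switch a b x y, switch a' b' x' y',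
      switch a'' b'' x'' y'', switch a''' b''' x''' y''']"] assms
  by (auto simp: switch_in_two_switches)

text \<open>A configuration found inside an active graph is the whole graph as soon as it carries as many
switches as the graph has, because each vertex takes part in some switch.\<close>

lemma verts_of_all_switches:
  assumes "simple_graph G" "active G"
    and "set ss \<subseteq> two_switches G" "distinct ss" "switch_degree G \<le> length ss"
  shows "verts G = (\<Union>s \<in> set ss. \<Union> (fst s))"
proof
  have all: "set ss = two_switches G"
    using card_seteq[OF finite_two_switches[OF assms(1)] assms(3)] assms(5) distinct_card[OF assms(4)]
    by (simp add: switch_degree_def)
  show "verts G \<subseteq> (\<Union>s \<in> set ss. \<Union> (fst s))"
  proof
    fix v assume "v \<in> verts G"
    then obtain a b x y where "switchable G a b x y" "v \<in> {a, b, x, y}"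
      using assms(2) by (auto simp: active_def active_vertex_def)
    then show "v \<in> (\<Union>s \<in> set ss. \<Union> (fst s))"
      unfolding all using switch_in_two_switches switch_support by (metis UN_I)
  qed
  show "(\<Union>s \<in> set ss. \<Union> (fst s)) \<subseteq> verts G"
  proof
    fix v assume "v \<in> (\<Union>s \<in> set ss. \<Union> (fst s))"
    then obtain s where s: "s \<in> two_switches G" "v \<in> \<Union> (fst s)"
      unfolding all by blast
    then obtain a b x y where "s = switch a b x y" "switchable G a b x y"
      unfolding two_switches_eq by blast
    with s(2) have "v \<in> {a, b, x, y}" "switchable G a b x y"
      using switch_support[of a b x y] by auto
    then show "v \<in> verts G"
      using switchable_verts[OF assms(1), of a b x y] by blast
  qed
qed

lemma simple_induced:
  assumes "simple_graph G" "X \<subseteq> verts G" "X \<noteq> {}"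
  shows "simple_graph (induced G X)"
proof -
  have "\<exists>u v. e = {u, v} \<and> u \<in> X \<and> v \<in> X \<and> u \<noteq> v" if "e \<in> edges G" "e \<subseteq> X" for e
  proof -
    have "e \<in> {{u, v} | u v. u \<in> verts G \<and> v \<in> verts G \<and> u \<noteq> v}"
      using assms(1) \<open>e \<in> edges G\<close> unfolding simple_graph_def by blast
    then obtain u v where "e = {u, v}" "u \<noteq> v" by blast
    with \<open>e \<subseteq> X\<close> show ?thesis by blast
  qed
  then have "edges (induced G X) \<subseteq> {{u, v} | u v. u \<in> X \<and> v \<in> X \<and> u \<noteq> v}"
    by (auto simp: induced_def)
  moreover have "finite X"
    using assms finite_subset by (auto simp: simple_graph_def)
  ultimately show ?thesis
    using assms(3) by (simp add: simple_graph_def induced_def)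
qed

lemma verts_induced [simp]: "verts (induced G X) = X"
  by (simp add: induced_def)

lemma adj_induced [simp]: "adj (induced G X) u v \<longleftrightarrow> adj G u v \<and> u \<in> X \<and> v \<in> X"
  by (auto simp: adj_def induced_def)

lemma induced_induced: "Y \<subseteq> X \<Longrightarrow> induced (induced G X) Y = induced G Y"
  by (auto simp: induced_def)

lemma switchable_induced:
  "switchable (induced G X) a b x y \<longleftrightarrow> switchable G a b x y \<and> {a, b, x, y} \<subseteq> X"
  by (auto simp: switchable_iff)

lemma verts_complement [simp]: "verts (complement G) = verts G"
  by (simp add: complement_def)

lemma adj_complement [simp]:
  "adj (complement G) u v \<longleftrightarrow> u \<in> verts G \<and> v \<in> verts G \<and> u \<noteq> v \<and> \<not> adj G u v"
proof -
  have "{u', v'} \<in> edges G \<longleftrightarrow> {v', u'} \<in> edges G" for u' v'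
    by (simp add: insert_commute)
  then show ?thesis
    unfolding adj_def complement_def by (simp add: doubleton_eq_iff) blast
qed

lemma simple_complement: "simple_graph G \<Longrightarrow> simple_graph (complement G)"
  by (auto simp: simple_graph_def complement_def)

lemma switchable_complement:
  assumes "simple_graph G"
  shows "switchable (complement G) a b x y \<longleftrightarrow> switchable G a x b y"
proof
  show "switchable G a x b y \<Longrightarrow> switchable (complement G) a b x y"
    using switchable_verts[OF assms, of a x b y] by (auto simp: switchable_iff)
qed (auto simp: switchable_iff)

lemma active_complement:
  assumes "simple_graph G" "active G"
  shows "active (complement G)"
  unfolding active_def active_vertex_def switchable_complement[OF assms(1)] verts_complement
proof
  fix v assume "v \<in> verts G"
  then obtain a b x y where "switchable G a b x y" "v \<in> {a, b, x, y}"
    using assms(2) by (auto simp: active_def active_vertex_def)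
  then show "\<exists>a b x y. switchable G a x b y \<and> v \<in> {a, b, x, y}"
    by (intro exI[of _ a] exI[of _ x] exI[of _ b] exI[of _ y]) auto
qed

text \<open>Passing to the complement exchanges the deleted and the added edges of each switch.\<close>

lemma switch_degree_complement:
  assumes "simple_graph G"
  shows "switch_degree (complement G) = switch_degree G"
proof -
  have "two_switches (complement G) = (\<lambda>(d, e). (e, d)) ` two_switches G"
    (is "?L = ?R")
  proof
    show "?L \<subseteq> ?R"
    proof
      fix s assume "s \<in> ?L"
      then obtain a b x y where s: "s = switch a b x y" "switchable G a x b y"
        unfolding two_switches_eq switchable_complement[OF assms] by blast
      then have "s = (\<lambda>(d, e). (e, d)) (switch a x b y)"
        by (simp add: switch_def)
      then show "s \<in> ?R"
        using switch_in_two_switches[OF s(2)] by blast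
    qed
    show "?R \<subseteq> ?L"
    proof
      fix s assume "s \<in> ?R"
      then obtain a b x y where s: "s = (\<lambda>(d, e). (e, d)) (switch a x b y)" "switchable G a x b y"
        unfolding two_switches_eq by blast
      then have "s = switch a b x y"
        by (simp add: switch_def)
      then show "s \<in> ?L"
        using switch_in_two_switches[of "complement G" a b x y] s(2)
        unfolding switchable_complement[OF assms] by blast
    qed
  qed
  then show ?thesis
    by (auto simp: switch_degree_def intro!: card_image inj_onI)
qed

lemma complement_complement:
  assumes "simple_graph G"
  shows "complement (complement G) = G"
proof -
  have "e \<in> edges (complement (complement G)) \<longleftrightarrow> e \<in> edges G" for e
  proof -
    have pairs: "\<exists>u v. e = {u, v} \<and> u \<in> verts G \<and> v \<in> verts G \<and> u \<noteq> v"
      if "e \<in> edges G \<or> e \<in> edges (complement (complement G))"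
      using that assms by (auto simp: simple_graph_def complement_def)
    have "{u, v} \<in> edges (complement (complement G)) \<longleftrightarrow> {u, v} \<in> edges G"
      if "u \<in> verts G" "v \<in> verts G" "u \<noteq> v" for u v
      using that adj_complement[of "complement G" u v] adj_complement[of G u v] by (simp add: adj_def)
    with pairs show ?thesis by metis
  qed
  then have "edges (complement (complement G)) = edges G" by blast
  then show ?thesis by (simp add: complement_def)
qed

section \<open>Tyshkevich decompositions\<close>

text \<open>The shape of a composition, seen from the composed graph: \<open>K\<close> and \<open>I\<close> are the bipartition of the left
factor and \<open>M\<close> is the vertex set of the right factor. In this form complements and regroupings of
factors are statements about sets, and no factor has to be constructed.\<close>

definition decomposition :: "'a graph \<Rightarrow> 'a set \<Rightarrow> 'a set \<Rightarrow> 'a set \<Rightarrow> bool" where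
  "decomposition G K I M \<longleftrightarrow> verts G = K \<union> I \<union> M \<and> K \<inter> I = {} \<and> (K \<union> I) \<inter> M = {} \<and>
     K \<union> I \<noteq> {} \<and> M \<noteq> {} \<and>
     (\<forall>u \<in> K. \<forall>v \<in> K. u \<noteq> v \<longrightarrow> adj G u v) \<and> (\<forall>u \<in> I. \<forall>v \<in> I. \<not> adj G u v) \<and>
     (\<forall>u \<in> K. \<forall>v \<in> M. adj G u v) \<and> (\<forall>u \<in> I. \<forall>v \<in> M. \<not> adj G u v)"

lemma edges_eqI:
  assumes "simple_graph G" "simple_graph H" "\<And>u v. adj G u v \<longleftrightarrow> adj H u v"
  shows "edges G = edges H"
proof -
  have sub: "edges X \<subseteq> edges Y"
    if "simple_graph X" "\<And>u v. adj X u v \<longleftrightarrow> adj Y u v" for X Y :: "'a graph"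
  proof
    fix e assume e: "e \<in> edges X"
    then have "e \<in> {{u, v} | u v. u \<in> verts X \<and> v \<in> verts X \<and> u \<noteq> v}"
      using that(1) unfolding simple_graph_def by blast
    then obtain u v where "e = {u, v}" by blast
    then show "e \<in> edges Y"
      using e that(2)[of u v] by (simp add: adj_def)
  qed
  show ?thesis
    using sub[of G H] sub[of H G] assms by blast
qed

lemma adj_tyshkevich:
  "adj (tyshkevich S H) u v \<longleftrightarrow> adj (graph_of S) u v \<or> adj H u v \<or>
     u \<in> clique S \<and> v \<in> verts H \<or> v \<in> clique S \<and> u \<in> verts H"
proof -
  have "{u, v} \<in> {{x, y} | x y. x \<in> clique S \<and> y \<in> verts H} \<longleftrightarrow>
      u \<in> clique S \<and> v \<in> verts H \<or> v \<in> clique S \<and> u \<in> verts H"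
    by (simp add: doubleton_eq_iff) blast
  then show ?thesis
    by (auto simp: adj_def tyshkevich_def)
qed

lemma simple_tyshkevich:
  assumes "split_triple S" "simple_graph H" "verts (graph_of S) \<inter> verts H = {}"
  shows "simple_graph (tyshkevich S H)"
proof -
  have S: "simple_graph (graph_of S)" "clique S \<subseteq> verts (graph_of S)"
    using assms(1) unfolding split_triple_def split_bipartition_def by auto
  let ?P = "\<lambda>X. {{u, v} | u v. u \<in> X \<and> v \<in> X \<and> u \<noteq> v}"
  have "edges (graph_of S) \<subseteq> ?P (verts (graph_of S) \<union> verts H)"
    using S(1) unfolding simple_graph_def by blast
  moreover have "edges H \<subseteq> ?P (verts (graph_of S) \<union> verts H)"
    using assms(2) unfolding simple_graph_def by blast
  moreover have "{{x, y} | x y. x \<in> clique S \<and> y \<in> verts H} \<subseteq> ?P (verts (graph_of S) \<union> verts H)"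
    using S(2) assms(3) by blast
  ultimately show ?thesis
    using S(1) assms(2) unfolding simple_graph_def tyshkevich_def by simp
qed

lemma decomposition_tyshkevich:
  assumes "split_triple S" "simple_graph H" "verts (graph_of S) \<inter> verts H = {}"
  shows "decomposition (tyshkevich S H) (clique S) (indep S) (verts H)"
proof -
  have S: "clique S \<union> indep S = verts (graph_of S)" "clique S \<inter> indep S = {}"
    "\<And>u v. u \<in> clique S \<Longrightarrow> v \<in> clique S \<Longrightarrow> u \<noteq> v \<Longrightarrow> adj (graph_of S) u v"
    "\<And>u v. u \<in> indep S \<Longrightarrow> v \<in> indep S \<Longrightarrow> \<not> adj (graph_of S) u v"
    "simple_graph (graph_of S)"
    using assms(1) unfolding split_triple_def split_bipartition_def adj_def by blast+
  have nonempty: "clique S \<union> indep S \<noteq> {}" "verts H \<noteq> {}"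
    using S(1,5) assms(2) by (auto simp: simple_graph_def)
  have adj_S: "u \<in> clique S \<union> indep S" "v \<in> clique S \<union> indep S" if "adj (graph_of S) u v" for u v
    using adjD[OF S(5) that] S(1) by simp_all
  have adj_H: "u \<in> verts H" "v \<in> verts H" if "adj H u v" for u v
    using adjD[OF assms(2) that] by simp_all
  have disj: "(clique S \<union> indep S) \<inter> verts H = {}"
    using assms(3) S(1) by simp
  show ?thesis
    unfolding decomposition_def adj_tyshkevich
  proof (intro conjI ballI impI)
    show "verts (tyshkevich S H) = clique S \<union> indep S \<union> verts H"
      using S(1) by (simp add: tyshkevich_def)
    show "\<not> (adj (graph_of S) u v \<or> adj H u v \<or> u \<in> clique S \<and> v \<in> verts H \<or>
        v \<in> clique S \<and> u \<in> verts H)" if "u \<in> indep S" "v \<in> indep S" for u v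
      using S(2,4) that disj adj_H by blast
    show "\<not> (adj (graph_of S) u v \<or> adj H u v \<or> u \<in> clique S \<and> v \<in> verts H \<or>
        v \<in> clique S \<and> u \<in> verts H)" if "u \<in> indep S" "v \<in> verts H" for u v
      using S(2) that disj adj_H adj_S by blast
  qed (use S(2,3) nonempty disj in auto)
qed

lemma decomposable_iff_decomposition:
  assumes "simple_graph G"
  shows "decomposable G \<longleftrightarrow> (\<exists>K I M. decomposition G K I M)"
proof
  show "decomposable G \<Longrightarrow> \<exists>K I M. decomposition G K I M"
    unfolding decomposable_def using decomposition_tyshkevich by metis
next
  assume "\<exists>K I M. decomposition G K I M"
  then obtain K I M where dec: "decomposition G K I M" by blast
  define S where "S = \<lparr>graph_of = induced G (K \<union> I), clique = K, indep = I\<rparr>"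
  have S: "graph_of S = induced G (K \<union> I)" "clique S = K" "indep S = I"
    by (simp_all add: S_def)
  have simple: "simple_graph (induced G (K \<union> I))" "simple_graph (induced G M)"
    using dec by (auto intro!: simple_induced[OF assms] simp: decomposition_def)
  have "split_bipartition (induced G (K \<union> I)) K I"
    unfolding split_bipartition_def adj_def[symmetric]
    using dec by (auto simp: decomposition_def)
  then have triple: "split_triple S"
    by (simp add: split_triple_def S simple)
  have disj: "verts (graph_of S) \<inter> verts (induced G M) = {}"
    using dec by (auto simp: S decomposition_def)
  have verts: "verts (tyshkevich S (induced G M)) = verts G"
    using dec by (auto simp: tyshkevich_def S decomposition_def)
  have adj: "adj (tyshkevich S (induced G M)) u v \<longleftrightarrow> adj G u v" for u v
  proof -
    have sides: "u \<in> K \<union> I \<union> M" "v \<in> K \<union> I \<union> M" if "adj G u v"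
      using adjD[OF assms that] dec by (simp_all add: decomposition_def)
    have cross: "adj G x y \<longleftrightarrow> x \<in> K" "adj G y x \<longleftrightarrow> x \<in> K" if "x \<in> K \<union> I" "y \<in> M" for x y
      using dec that by (auto simp: decomposition_def adj_commute)
    have disj: "(K \<union> I) \<inter> M = {}"
      using dec by (simp add: decomposition_def)
    consider "u \<in> K \<union> I" "v \<in> K \<union> I" | "u \<in> M" "v \<in> M" | "u \<in> K \<union> I" "v \<in> M"
      | "u \<in> M" "v \<in> K \<union> I" | "\<not> adj G u v" "\<not> (u \<in> K \<union> I \<union> M \<and> v \<in> K \<union> I \<union> M)"
      using sides by blast
    then show ?thesis
    proof cases
      case 3
      then show ?thesis using cross[of u v] disj
        unfolding adj_tyshkevich S verts_induced adj_induced by blast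
    next
      case 4
      then show ?thesis using cross[of v u] disj
        unfolding adj_tyshkevich S verts_induced adj_induced by blast
    qed (use disj in \<open>unfold adj_tyshkevich S verts_induced adj_induced; blast\<close>)+
  qed
  have "edges (tyshkevich S (induced G M)) = edges G"
  proof (rule edges_eqI)
    show "simple_graph (tyshkevich S (induced G M))"
      using simple_tyshkevich[OF triple simple(2) disj] .
  qed (use assms adj in auto)
  then have "G = tyshkevich S (induced G M)"
    using verts by simp
  then show "decomposable G"
    unfolding decomposable_def using triple simple(2) disj by blast
qed

lemma decomposition_complement:
  assumes "simple_graph G" "decomposition G K I M"
  shows "decomposition (complement G) I K M"
proof -
  have sets: "verts G = K \<union> I \<union> M" "K \<inter> I = {}" "(K \<union> I) \<inter> M = {}" "K \<union> I \<noteq> {}" "M \<noteq> {}"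
    using assms(2) unfolding decomposition_def by simp_all
  have dec: "\<forall>u \<in> K. \<forall>v \<in> K. u \<noteq> v \<longrightarrow> adj G u v" "\<forall>u \<in> I. \<forall>v \<in> I. \<not> adj G u v"
    "\<forall>u \<in> K. \<forall>v \<in> M. adj G u v" "\<forall>u \<in> I. \<forall>v \<in> M. \<not> adj G u v"
    using assms(2) unfolding decomposition_def by simp_all
  have 1: "\<forall>u \<in> I. \<forall>v \<in> I. u \<noteq> v \<longrightarrow> u \<in> verts G \<and> v \<in> verts G \<and> u \<noteq> v \<and> \<not> adj G u v"
    using sets(1) dec(2) by simp
  have 2: "\<forall>u \<in> I. \<forall>v \<in> M. u \<in> verts G \<and> v \<in> verts G \<and> u \<noteq> v \<and> \<not> adj G u v"
    using sets(1,3) dec(4) by auto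
  have 3: "\<forall>u \<in> K. \<forall>v \<in> K. \<not> (u \<in> verts G \<and> v \<in> verts G \<and> u \<noteq> v \<and> \<not> adj G u v)"
    "\<forall>u \<in> K. \<forall>v \<in> M. \<not> (u \<in> verts G \<and> v \<in> verts G \<and> u \<noteq> v \<and> \<not> adj G u v)"
    using dec(1,3) by auto
  show ?thesis
    unfolding decomposition_def verts_complement adj_complement
    using 1 2 3 sets by (simp add: Un_commute Int_commute)
qed

lemma decomposable_complement:
  assumes "simple_graph G"
  shows "decomposable (complement G) \<longleftrightarrow> decomposable G"
  using decomposition_complement[OF assms] decomposition_complement[OF simple_complement[OF assms]]
  unfolding decomposable_iff_decomposition[OF assms] decomposable_iff_decomposition[OF simple_complement[OF assms]]
    complement_complement[OF assms] by blast

text \<open>Let \<open>W\<close> induce a split graph and let every outside vertex see all of \<open>W\<close> (set \<open>A\<close> below), exactly its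
clique part (\<open>B\<close>), or nothing (\<open>C\<close>). If \<open>A\<close> is a clique complete to \<open>B\<close>, and \<open>C\<close> is independent and
without edges to \<open>B\<close>, then \<open>A \<union> C\<close> is the left factor of a decomposition with right factor
\<open>W \<union> B\<close>; edges between \<open>A\<close> and \<open>C\<close> are unrestricted. If \<open>A \<union> C\<close> is empty, \<open>W\<close> itself is the left factor.
Both \<open>K\<close> and \<open>I\<close> are nonempty in order that the three kinds exclude each other.\<close>

lemma decomposable_of_uniform:
  assumes "simple_graph G" "W = K \<union> I" "W \<subseteq> verts G" "K \<inter> I = {}" "K \<noteq> {}" "I \<noteq> {}"
    and clique: "\<forall>u \<in> K. \<forall>v \<in> K. u \<noteq> v \<longrightarrow> adj G u v"
    and indep: "\<forall>u \<in> I. \<forall>v \<in> I. \<not> adj G u v"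
    and uniform: "\<And>v. v \<in> verts G - W \<Longrightarrow>
      (\<forall>w \<in> W. adj G v w) \<or> (\<forall>w \<in> K. adj G v w) \<and> (\<forall>w \<in> I. \<not> adj G v w) \<or>
      (\<forall>w \<in> W. \<not> adj G v w)"
    and dominating: "\<And>u v. \<lbrakk>u \<in> verts G - W; v \<in> verts G - W; u \<noteq> v;
      \<forall>w \<in> W. adj G u w; \<forall>w \<in> K. adj G v w\<rbrakk> \<Longrightarrow> adj G u v"
    and isolated: "\<And>u v. \<lbrakk>u \<in> verts G - W; v \<in> verts G - W; u \<noteq> v;
      \<forall>w \<in> W. \<not> adj G u w; \<forall>w \<in> I. \<not> adj G v w\<rbrakk> \<Longrightarrow> \<not> adj G u v"
  shows "verts G = W \<or> decomposable G"
proof -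
  define A where "A = {v \<in> verts G - W. \<forall>w \<in> W. adj G v w}"
  define B where "B = {v \<in> verts G - W. (\<forall>w \<in> K. adj G v w) \<and> (\<forall>w \<in> I. \<not> adj G v w)}"
  define C where "C = {v \<in> verts G - W. \<forall>w \<in> W. \<not> adj G v w}"
  have V: "verts G = A \<union> B \<union> C \<union> W"
  proof
    show "verts G \<subseteq> A \<union> B \<union> C \<union> W"
    proof
      fix v assume "v \<in> verts G"
      with uniform[of v] show "v \<in> A \<union> B \<union> C \<union> W"
        by (auto simp: A_def B_def C_def)
    qed
    show "A \<union> B \<union> C \<union> W \<subseteq> verts G"
      using assms(3) by (auto simp: A_def B_def C_def)
  qed
  have AB: "adj G u v" if "u \<in> A" "v \<in> A \<union> B" "u \<noteq> v" for u v
    using dominating[of u v] that assms(2) by (auto simp: A_def B_def)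
  have CB: "\<not> adj G u v" if "u \<in> C" "v \<in> C \<union> B" for u v
    using isolated[of u v] that adj_irrefl[OF assms(1), of u] assms(2) by (cases "u = v") (auto simp: B_def C_def)
  have disjoint: "A \<inter> B = {}" "A \<inter> C = {}" "B \<inter> C = {}" "(A \<union> B \<union> C) \<inter> W = {}"
    using assms(2,5,6) by (auto simp: A_def B_def C_def)
  consider "A \<union> C \<noteq> {}" | "A \<union> C = {}" "B \<noteq> {}" | "A \<union> B \<union> C = {}" by blast
  then show ?thesis
  proof cases
    case 1
    have "decomposition G A C (W \<union> B)"
      unfolding decomposition_def
    proof (intro conjI ballI impI)
      show "adj G u v" if "u \<in> A" "v \<in> W \<union> B" for u v
        using that AB[of u v] disjoint(1) by (auto simp: A_def)
      show "\<not> adj G u v" if "u \<in> C" "v \<in> W \<union> B" for u v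
        using that CB[of u v] by (auto simp: C_def)
      show "adj G u v" if "u \<in> A" "v \<in> A" "u \<noteq> v" for u v
        using that AB by simp
      show "\<not> adj G u v" if "u \<in> C" "v \<in> C" for u v
        using that CB by simp
      show "verts G = A \<union> C \<union> (W \<union> B)"
        using V by (simp add: Un_ac)
      show "A \<union> C \<noteq> {}" "W \<union> B \<noteq> {}" "A \<inter> C = {}"
        using 1 assms(2,5) disjoint by auto
      show "(A \<union> C) \<inter> (W \<union> B) = {}"
        using disjoint by (simp add: Int_Un_distrib Int_Un_distrib2 Int_commute)
    qed
    then show ?thesis
      using decomposable_iff_decomposition[OF assms(1)] by blast
  next
    case 2
    have "decomposition G K I B"
      unfolding decomposition_def assms(2)[symmetric]
    proof (intro conjI ballI impI)
      show "adj G u v" if "u \<in> K" "v \<in> B" for u v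
        using that by (simp add: B_def adj_commute)
      show "\<not> adj G u v" if "u \<in> I" "v \<in> B" for u v
        using that by (simp add: B_def adj_commute)
      show "verts G = W \<union> B"
        using V 2(1) by (simp add: Un_ac)
      show "W \<noteq> {}" "B \<noteq> {}" "K \<inter> I = {}"
        using 2(2) assms(2,4,5) by auto
      show "W \<inter> B = {}"
        by (auto simp: B_def)
    qed (use clique indep in simp_all)
    then show ?thesis
      using decomposable_iff_decomposition[OF assms(1)] by blast
  qed (use V in auto)
qed

section \<open>Neighbours of small configurations\<close>

text \<open>The six predicates below describe induced subgraphs with named vertices, so that adjacency within
them is decided by rewriting. The last four are \<open>D\<^sub>2\<^sub>1\<close>, \<open>D\<^sub>3\<^sub>1\<close>, \<open>T\<^sub>1\<^sub>1\<^sub>1\<close> and \<open>T\<^sub>2\<^sub>2\<^sub>1\<close>, with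
\<open>a, b, c\<close> for the independent set and \<open>k, l, m, n\<close> for the clique. An induced \<open>C\<^sub>4\<close> is treated as
\<open>two_edges\<close> in the complement.\<close>

definition path4 :: "'a graph \<Rightarrow> 'a \<Rightarrow> 'a \<Rightarrow> 'a \<Rightarrow> 'a \<Rightarrow> bool" where
  "path4 G p q r s \<longleftrightarrow> distinct [p, q, r, s] \<and> adj G p q \<and> adj G q r \<and> adj G r s \<and>
     \<not> adj G p r \<and> \<not> adj G q s \<and> \<not> adj G p s"

definition two_edges :: "'a graph \<Rightarrow> 'a \<Rightarrow> 'a \<Rightarrow> 'a \<Rightarrow> 'a \<Rightarrow> bool" where
  "two_edges G p q r s \<longleftrightarrow> distinct [p, q, r, s] \<and> adj G p q \<and> adj G r s \<and>
     \<not> adj G p r \<and> \<not> adj G p s \<and> \<not> adj G q r \<and> \<not> adj G q s"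

definition d21 :: "'a graph \<Rightarrow> 'a \<Rightarrow> 'a \<Rightarrow> 'a \<Rightarrow> 'a \<Rightarrow> 'a \<Rightarrow> bool" where
  "d21 G a b k l m \<longleftrightarrow> distinct [a, b, k, l, m] \<and>
     adj G k l \<and> adj G k m \<and> adj G l m \<and> \<not> adj G a b \<and>
     adj G a k \<and> \<not> adj G a l \<and> \<not> adj G a m \<and>
     \<not> adj G b k \<and> adj G b l \<and> adj G b m"

definition d31 :: "'a graph \<Rightarrow> 'a \<Rightarrow> 'a \<Rightarrow> 'a \<Rightarrow> 'a \<Rightarrow> 'a \<Rightarrow> 'a \<Rightarrow> bool" where
  "d31 G a b k l m n \<longleftrightarrow> distinct [a, b, k, l, m, n] \<and>
     adj G k l \<and> adj G k m \<and> adj G k n \<and> adj G l m \<and> adj G l n \<and> adj G m n \<and> \<not> adj G a b \<and>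
     adj G a k \<and> \<not> adj G a l \<and> \<not> adj G a m \<and> \<not> adj G a n \<and>
     \<not> adj G b k \<and> adj G b l \<and> adj G b m \<and> adj G b n"

definition t111 :: "'a graph \<Rightarrow> 'a \<Rightarrow> 'a \<Rightarrow> 'a \<Rightarrow> 'a \<Rightarrow> 'a \<Rightarrow> 'a \<Rightarrow> bool" where
  "t111 G a b c k l m \<longleftrightarrow> distinct [a, b, c, k, l, m] \<and>
     adj G k l \<and> adj G k m \<and> adj G l m \<and> \<not> adj G a b \<and> \<not> adj G a c \<and> \<not> adj G b c \<and>
     adj G a k \<and> \<not> adj G a l \<and> \<not> adj G a m \<and>
     \<not> adj G b k \<and> adj G b l \<and> \<not> adj G b m \<and>
     \<not> adj G c k \<and> \<not> adj G c l \<and> adj G c m"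

definition t221 :: "'a graph \<Rightarrow> 'a \<Rightarrow> 'a \<Rightarrow> 'a \<Rightarrow> 'a \<Rightarrow> 'a \<Rightarrow> 'a \<Rightarrow> bool" where
  "t221 G a b c k l m \<longleftrightarrow> distinct [a, b, c, k, l, m] \<and>
     adj G k l \<and> adj G k m \<and> adj G l m \<and> \<not> adj G a b \<and> \<not> adj G a c \<and> \<not> adj G b c \<and>
     \<not> adj G a k \<and> adj G a l \<and> \<not> adj G a m \<and>
     adj G b k \<and> \<not> adj G b l \<and> adj G b m \<and>
     \<not> adj G c k \<and> adj G c l \<and> adj G c m"

text \<open>The pairs \<open>ay\<close> and \<open>bx\<close> are free in an alternating 4-cycle: with both present it induces \<open>C\<^sub>4\<close>, with
neither \<open>2K\<^sub>2\<close>, with exactly one a path.\<close>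

lemma switchable_cases:
  assumes "simple_graph G" "switchable G a b x y"
  obtains p q r s where "path4 G p q r s"
    | p q r s where "two_edges G p q r s"
    | p q r s where "two_edges (complement G) p q r s"
proof -
  note V = switchable_verts[OF assms]
  consider "adj G b x" "adj G a y" | "adj G b x" "\<not> adj G a y" | "\<not> adj G b x" "adj G a y"
    | "\<not> adj G b x" "\<not> adj G a y" by blast
  then show thesis
  proof cases
    case 1
    then have "two_edges (complement G) a x b y"
      using assms(2) V by (auto simp: two_edges_def switchable_iff adj_commute)
    then show thesis by (rule that)
  next
    case 2
    then have "path4 G a b x y"
      using assms(2) by (auto simp: path4_def switchable_iff adj_commute)
    then show thesis by (rule that)
  next
    case 3
    then have "path4 G b a y x"
      using assms(2) by (auto simp: path4_def switchable_iff adj_commute)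
    then show thesis by (rule that)
  next
    case 4
    then have "two_edges G a b x y"
      using assms(2) by (auto simp: two_edges_def switchable_iff adj_commute)
    then show thesis by (rule that)
  qed
qed

lemma path4_rev: "path4 G p q r s \<Longrightarrow> path4 G s r q p"
  by (auto simp: path4_def adj_commute)

lemma path4_verts:
  assumes "simple_graph G" "path4 G p q r s"
  shows "{p, q, r, s} \<subseteq> verts G"
  using assms(2) by (auto simp: path4_def dest: adjD(1)[OF assms(1)] adjD(2)[OF assms(1)])

text \<open>The complement of a path on four vertices is a path whose inner vertices are the former ends.\<close>

lemma path4_complement:
  assumes "simple_graph G" "path4 G p q r s"
  shows "path4 (complement G) q s p r"
  using assms(2) path4_verts[OF assms] by (auto simp: path4_def adj_commute)

lemmas switch_simps = switchable_iff switch_def doubleton_eq_iff adj_commute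

text \<open>A vertex that sees an end of the path but not both inner vertices creates at least three further
switches on these five vertices; such vertices produce for instance \<open>P\<^sub>5\<close>, \<open>C\<^sub>5\<close> or the house.\<close>

lemma path4_end_neighbour:
  assumes "simple_graph G" "switch_degree G \<le> 3" "path4 G p q r s"
    and "v \<notin> {p, q, r, s}" "adj G v p"
  shows "adj G v q \<and> adj G v r"
proof (rule ccontr)
  note four = not_four_switches[OF assms(1,2)]
  assume "\<not> (adj G v q \<and> adj G v r)"
  then consider "\<not> adj G v q" "adj G v r" "adj G v s" | "\<not> adj G v q" "adj G v r" "\<not> adj G v s"
    | "\<not> adj G v q" "\<not> adj G v r" "adj G v s" | "\<not> adj G v q" "\<not> adj G v r" "\<not> adj G v s"
    | "adj G v q" "\<not> adj G v r" "adj G v s" | "adj G v q" "\<not> adj G v r" "\<not> adj G v s" by blast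
  then show False
  proof cases
    case 1
    then show False using four[of p q r s p v r q p q r v p q s v] assms(3-)
      by (auto simp: path4_def switch_simps)
  next
    case 2
    then show False using four[of p q r s p v r q p q r v p v r s] assms(3-)
      by (auto simp: path4_def switch_simps)
  next
    case 3
    then show False using four[of p q r s p v r q p v s r p q s v] assms(3-)
      by (auto simp: path4_def switch_simps)
  next
    case 4
    then show False using four[of p q r s p v r q p v s r p v r s] assms(3-)
      by (auto simp: path4_def switch_simps)
  next
    case 5
    then show False using four[of p q r s p v s r q v s r q r s v] assms(3-)
      by (auto simp: path4_def switch_simps)
  next
    case 6
    then show False using four[of p q r s p v s r q v s r p v r s] assms(3-)
      by (auto simp: path4_def switch_simps)
  qed
qed

lemma two_edges_verts:
  assumes "simple_graph G" "two_edges G p q r s"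
  shows "{p, q, r, s} \<subseteq> verts G"
  using assms(2) by (auto simp: two_edges_def dest: adjD(1)[OF assms(1)] adjD(2)[OF assms(1)])

text \<open>The two edges carry two switches already. A vertex that sees \<open>p\<close> and misses \<open>r\<close> adds two more, whatever
its other adjacencies are.\<close>

lemma two_edges_neighbour_across:
  assumes "simple_graph G" "switch_degree G \<le> 3" "two_edges G p q r s"
    and "v \<notin> {p, q, r, s}" "adj G v p"
  shows "adj G v r"
proof (rule ccontr)
  note four = not_four_switches[OF assms(1,2)]
  assume "\<not> adj G v r"
  then consider "\<not> adj G v r" "adj G v q" | "\<not> adj G v r" "\<not> adj G v q" "adj G v s"
    | "\<not> adj G v r" "\<not> adj G v q" "\<not> adj G v s" by blast
  then show False
  proof cases
    case 1
    then show False using four[of p q r s p q s r p v s r q v s r] assms(3-)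
      by (auto simp: two_edges_def switch_simps)
  next
    case 2
    then show False using four[of p q r s p q s r p v s r p q s v] assms(3-)
      by (auto simp: two_edges_def switch_simps)
  next
    case 3
    then show False using four[of p q r s p q s r p v s r p v r s] assms(3-)
      by (auto simp: two_edges_def switch_simps)
  qed
qed

text \<open>Crossing between the two edges by \<open>two_edges_neighbour_across\<close> spreads one adjacency to all four
vertices.\<close>

lemma two_edges_uniform:
  assumes "simple_graph G" "switch_degree G \<le> 3" "two_edges G p q r s"
    and "v \<notin> {p, q, r, s}" "adj G v x" "x \<in> {p, q, r, s}" "y \<in> {p, q, r, s}"
  shows "adj G v y"
proof -
  have step: "adj G v r' \<and> adj G v s' \<and> adj G v p' \<and> adj G v q'"
    if te: "two_edges G p' q' r' s'" and "v \<notin> {p', q', r', s'}" "adj G v p'" for p' q' r' s'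
  proof -
    have te': "two_edges G r' s' p' q'" "two_edges G p' q' s' r'" "two_edges G r' s' q' p'"
      using te by (auto simp: two_edges_def adj_commute)
    have "adj G v r'" "adj G v s'"
      using two_edges_neighbour_across[OF assms(1,2) te] two_edges_neighbour_across[OF assms(1,2) te'(2)] that
      by auto
    moreover have "adj G v q'"
      using two_edges_neighbour_across[OF assms(1,2) te'(3)] that(2) \<open>adj G v r'\<close> by auto
    ultimately show ?thesis using that by blast
  qed
  have "two_edges G q p r s" "two_edges G r s p q" "two_edges G s r p q"
    using assms(3) by (auto simp: two_edges_def adj_commute)
  with step[of p q r s] step[of q p r s] step[of r s p q] step[of s r p q] assms(3-)
  show ?thesis by fastforce
qed

text \<open>Two non-adjacent vertices that both see the whole path form a \<open>C\<^sub>4\<close> with any non-adjacent pair of the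
path, which gives too many switches.\<close>

lemma path4_pair_all:
  assumes "simple_graph G" "switch_degree G \<le> 3" "path4 G p q r s"
    and "u \<notin> {p, q, r, s}" "v \<notin> {p, q, r, s}" "u \<noteq> v"
    and "\<forall>x \<in> {p, q, r, s}. adj G u x" "\<forall>x \<in> {p, q, r, s}. adj G v x"
  shows "adj G u v"
  using not_four_switches[OF assms(1,2), of p q r s p u r v s u q v r u p v] assms(3-)
  by (auto simp: path4_def switch_simps)

lemma d21_paths:
  assumes "d21 G a b k l m"
  shows "path4 G a k l b" "path4 G a k m b"
  using assms by (auto simp: d21_def path4_def adj_commute)

lemma d21_switches:
  assumes "d21 G a b k l m"
  shows "switchable G a k l b" "switchable G a k m b" "distinct [switch a k l b, switch a k m b]"
  using assms by (auto simp: d21_def switch_simps)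

text \<open>Every outside vertex sees all of \<open>2K\<^sub>2\<close> or nothing of it, and two vertices of the same kind that are
wrongly related would add another \<open>C\<^sub>4\<close> or \<open>2K\<^sub>2\<close>. Hence the outside vertices, if any, form a split left factor.\<close>

lemma two_edges_grow:
  assumes "simple_graph G" "switch_degree G \<le> 3" "two_edges G p q r s"
  shows "verts G = {p, q, r, s} \<or> decomposable G"
proof -
  let ?Q = "{p, q, r, s}"
  note four = not_four_switches[OF assms(1,2)]
  define A where "A = {v \<in> verts G - ?Q. \<forall>w \<in> ?Q. adj G v w}"
  define C where "C = {v \<in> verts G - ?Q. \<forall>w \<in> ?Q. \<not> adj G v w}"
  have V: "verts G = A \<union> C \<union> ?Q"
  proof
    show "verts G \<subseteq> A \<union> C \<union> ?Q"
    proof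
      fix v assume "v \<in> verts G"
      show "v \<in> A \<union> C \<union> ?Q"
      proof (cases "v \<in> ?Q")
        case False
        have "(\<forall>w \<in> ?Q. adj G v w) \<or> (\<forall>w \<in> ?Q. \<not> adj G v w)"
          using two_edges_uniform[OF assms False] by meson
        then show ?thesis
          using \<open>v \<in> verts G\<close> False unfolding A_def C_def by simp
      qed auto
    qed
    show "A \<union> C \<union> ?Q \<subseteq> verts G"
      using two_edges_verts[OF assms(1,3)] by (auto simp: A_def C_def)
  qed
  \<comment> \<open>A missing edge in \<open>A\<close> closes a \<open>C\<^sub>4\<close> with \<open>p\<close> and \<open>r\<close>.\<close>
  have A_clique: "adj G u v" if "u \<in> A" "v \<in> A" "u \<noteq> v" for u v
    using four[of p q r s p q s r u p v r u r v p] assms(3) that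
    by (auto simp: A_def two_edges_def switch_simps)
  have C_indep: "\<not> adj G u v" if "u \<in> C" "v \<in> C" for u v
    using four[of p q r s p q s r u v p q u v q p] assms(3) that adj_irrefl[OF assms(1), of u]
    by (auto simp: C_def two_edges_def switch_simps)
  show ?thesis
  proof (cases "A \<union> C = {}")
    case False
    have "decomposition G A C ?Q"
      unfolding decomposition_def
    proof (intro conjI ballI impI)
      show "A \<inter> C = {}" "(A \<union> C) \<inter> ?Q = {}"
        by (auto simp: A_def C_def)
      show "adj G u v" if "u \<in> A" "v \<in> ?Q" for u v
        using that unfolding A_def by blast
      show "\<not> adj G u v" if "u \<in> C" "v \<in> ?Q" for u v
        using that unfolding C_def by blast
    qed (use V A_clique C_indep False in simp_all)
    then show ?thesis
      using decomposable_iff_decomposition[OF assms(1)] by blast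
  qed (use V in simp)
qed

text \<open>If \<open>v\<close> sees only the inner vertices of the path and \<open>u\<close>, which sees the whole path, misses \<open>v\<close>, then the
six vertices induce the complement of \<open>T\<^sub>1\<^sub>1\<^sub>1\<close>; two vertices that see the whole path are covered by
\<open>path4_pair_all\<close>.\<close>

lemma path4_dominating:
  assumes "simple_graph G" "switch_degree G \<le> 3" "path4 G p q r s"
    and "u \<in> verts G - {p, q, r, s}" "v \<in> verts G - {p, q, r, s}" "u \<noteq> v"
    and "\<forall>x \<in> {p, q, r, s}. adj G u x" "adj G v q" "adj G v r"
    and "\<nexists>a b c k l m. t111 (complement G) a b c k l m"
    and "adj G v p \<longleftrightarrow> adj G v s"
  shows "adj G u v"
proof (rule ccontr)
  assume non: "\<not> adj G u v"
  show False
  proof (cases "adj G v p")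
    case True
    then show False
      using path4_pair_all[OF assms(1-3), of u v] assms(4-9,11) non by auto
  next
    case False
    then have "t111 (complement G) u q r v s p"
      using assms(3-9,11) non path4_verts[OF assms(1,3)]
      by (auto simp: t111_def path4_def adj_commute)
    then show False
      using assms(10) by blast
  qed
qed

text \<open>By \<open>path4_end_neighbour\<close>, seven kinds of outside vertices are possible. Those that see exactly one end
give \<open>D\<^sub>2\<^sub>1\<close>, those that see exactly one inner vertex give its complement, and the remaining three kinds
are the uniform ones. Complementation exchanges \<open>T\<^sub>1\<^sub>1\<^sub>1\<close> with its complement and the dominating vertices
with the isolated ones, so \<open>path4_dominating\<close> handles both relations between uniform vertices.\<close>

lemma path4_grow:
  assumes "simple_graph G" "switch_degree G \<le> 3" "path4 G p q r s"
    and no_d21: "\<nexists>a b k l m. d21 G a b k l m" "\<nexists>a b k l m. d21 (complement G) a b k l m"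
    and no_t111: "\<nexists>a b c k l m. t111 G a b c k l m" "\<nexists>a b c k l m. t111 (complement G) a b c k l m"
  shows "verts G = {p, q, r, s} \<or> decomposable G"
proof -
  have simple': "simple_graph (complement G)" and deg': "switch_degree (complement G) \<le> 3"
    using simple_complement[OF assms(1)] switch_degree_complement[OF assms(1)] assms(2) by simp_all
  note PV = path4_verts[OF assms(1,3)]
  have ends: "adj G v p \<longleftrightarrow> adj G v s"
    if G: "simple_graph G" "switch_degree G \<le> 3" "path4 G p q r s" "\<nexists>a b k l m. d21 G a b k l m"
      and v: "v \<notin> {p, q, r, s}" for G :: "'a graph" and v p q r s
  proof -
    have "d21 G s p r q v" if "adj G v p" "\<not> adj G v s"
      using path4_end_neighbour[OF G(1-3) v that(1)] that v G(3)
      by (auto simp: d21_def path4_def adj_commute)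
    moreover have "d21 G p s q r v" if "adj G v s" "\<not> adj G v p"
      using path4_end_neighbour[OF G(1,2) path4_rev[OF G(3)], of v] that v G(3)
      by (auto simp: d21_def path4_def adj_commute)
    ultimately show ?thesis
      using G(4) by blast
  qed
  note path' = path4_complement[OF assms(1,3)]
  \<comment> \<open>In the complement the ends of the path are \<open>q\<close> and \<open>r\<close>, so the same fact treats the inner vertices.\<close>
  have outer: "adj G v p \<longleftrightarrow> adj G v s" if "v \<notin> {p, q, r, s}" for v
    using ends[OF assms(1-3) no_d21(1) that] .
  have inner: "adj G v q \<longleftrightarrow> adj G v r" if "v \<notin> {p, q, r, s}" "v \<in> verts G" for v
    using ends[OF simple' deg' path' no_d21(2), of v] that PV by auto
  have both: "adj G v q" if "v \<notin> {p, q, r, s}" "v \<in> verts G" "adj G v p" for v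
    using path4_end_neighbour[OF assms(1-3) that(1,3)] by blast
  show ?thesis
  proof (rule decomposable_of_uniform[where K = "{q, r}" and I = "{p, s}"])
    show "simple_graph G" by (rule assms(1))
    show "{p, q, r, s} = {q, r} \<union> {p, s}" by blast
    show "{p, q, r, s} \<subseteq> verts G" by (rule PV)
    show "(\<forall>w\<in>{p, q, r, s}. adj G v w) \<or> (\<forall>w\<in>{q, r}. adj G v w) \<and> (\<forall>w\<in>{p, s}. \<not> adj G v w) \<or>
        (\<forall>w\<in>{p, q, r, s}. \<not> adj G v w)" if "v \<in> verts G - {p, q, r, s}" for v
    proof -
      have "v \<notin> {p, q, r, s}" "v \<in> verts G" using that by auto
      from outer[OF this(1)] inner[OF this] both[OF this] show ?thesis
        by (cases "adj G v p"; cases "adj G v q") simp_all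
    qed
    show "adj G u v" if "u \<in> verts G - {p, q, r, s}" "v \<in> verts G - {p, q, r, s}" "u \<noteq> v"
      "\<forall>w\<in>{p, q, r, s}. adj G u w" "\<forall>w\<in>{q, r}. adj G v w" for u v
    proof (rule path4_dominating[OF assms(1-3) that(1-4) _ _ no_t111(2)])
      show "adj G v p \<longleftrightarrow> adj G v s" using outer[of v] that(2) by simp
    qed (use that(5) in simp_all)
    show "\<not> adj G u v" if "u \<in> verts G - {p, q, r, s}" "v \<in> verts G - {p, q, r, s}" "u \<noteq> v"
      "\<forall>w\<in>{p, q, r, s}. \<not> adj G u w" "\<forall>w\<in>{p, s}. \<not> adj G v w" for u v
    proof -
      have "adj (complement G) u v"
      proof (rule path4_dominating[OF simple' deg' path', unfolded complement_complement[OF assms(1)]])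
        show "\<nexists>a b c k l m. t111 G a b c k l m" by (rule no_t111(1))
        show "adj (complement G) v q \<longleftrightarrow> adj (complement G) v r"
          using inner[of v] that(2) PV by simp
      qed (use that PV in auto)
      then show ?thesis by simp
    qed
  qed (use assms(3) in \<open>auto simp: path4_def adj_commute adj_irrefl[OF assms(1)]\<close>)
qed

lemma d21_verts:
  assumes "simple_graph G" "d21 G a b k l m"
  shows "{a, b, k, l, m} \<subseteq> verts G"
  using assms(2) by (auto simp: d21_def dest: adjD(1)[OF assms(1)] adjD(2)[OF assms(1)])

text \<open>\<open>D\<^sub>2\<^sub>1\<close> contains the paths \<open>a k l b\<close> and \<open>a k m b\<close>, and \<open>path4_end_neighbour\<close> applies to both. A vertex
that sees \<open>a\<close> or \<open>b\<close> therefore sees the clique; seeing \<open>b\<close> alone gives \<open>D\<^sub>3\<^sub>1\<close>, seeing \<open>a\<close> alone gives two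
more switches. Among the vertices that miss \<open>a\<close> and \<open>b\<close>, those that see exactly \<open>k, l\<close> or exactly \<open>k, m\<close>
give \<open>T\<^sub>2\<^sub>2\<^sub>1\<close>, those that see only \<open>l\<close> or only \<open>m\<close> give its complement, and those that see only \<open>k\<close> or
exactly \<open>l, m\<close> give two more switches.\<close>

lemma d21_neighbour:
  assumes "simple_graph G" "switch_degree G \<le> 3" "d21 G a b k l m" "v \<in> verts G - {a, b, k, l, m}"
    and "\<nexists>a b k l m n. d31 G a b k l m n"
    and "\<nexists>a b c k l m. t221 G a b c k l m" "\<nexists>a b c k l m. t221 (complement G) a b c k l m"
  shows "(\<forall>w \<in> {a, b, k, l, m}. adj G v w) \<or> (\<forall>w \<in> {k, l, m}. adj G v w) \<and> (\<forall>w \<in> {a, b}. \<not> adj G v w) \<or>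
      (\<forall>w \<in> {a, b, k, l, m}. \<not> adj G v w)"
proof -
  note four = not_four_switches[OF assms(1,2)]
  note D = assms(3)
  have v: "v \<notin> {a, b, k, l, m}" "v \<in> verts G" using assms(4) by auto
  have D': "d21 G a b k m l" using D by (auto simp: d21_def adj_commute)
  have a: "adj G v k" "adj G v l" "adj G v m" if "adj G v a"
    using path4_end_neighbour[OF assms(1,2) d21_paths(1)[OF D] _ that]
      path4_end_neighbour[OF assms(1,2) d21_paths(2)[OF D] _ that] v by auto
  have b: "adj G v k" "adj G v l" "adj G v m" if "adj G v b"
    using path4_end_neighbour[OF assms(1,2) path4_rev[OF d21_paths(1)[OF D]] _ that]
      path4_end_neighbour[OF assms(1,2) path4_rev[OF d21_paths(2)[OF D]] _ that] v by auto
  consider "adj G v a" "adj G v b" | "adj G v a" "\<not> adj G v b" | "\<not> adj G v a" "adj G v b"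
    | "\<not> adj G v a" "\<not> adj G v b" by blast
  then show ?thesis
  proof cases
    case 1
    then show ?thesis using a by simp
  next
    case 2
    then show ?thesis using a four[of a k l b a k m b a v l b a v m b] D v
      by (auto simp: d21_def switch_simps)
  next
    case 3
    then have "d31 G a b k l m v"
      using b D v by (auto simp: d21_def d31_def adj_commute)
    then show ?thesis using assms(5) by blast
  next
    case 4
    note ab = 4
    have single: "adj G v k \<or> adj G v m'" if d: "d21 G a b k l' m'" "v \<notin> {a, b, k, l', m'}" "adj G v l'" for l' m'
    proof (rule ccontr)
      assume "\<not> (adj G v k \<or> adj G v m')"
      then have "t221 (complement G) l' k m' b a v"
        using d ab v(2) d21_verts[OF assms(1) d(1)] by (auto simp: d21_def t221_def adj_commute)
      then show False using assms(7) by blast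
    qed
    have two: "adj G v m'" if d: "d21 G a b k l' m'" "v \<notin> {a, b, k, l', m'}" "adj G v l'" "adj G v k" for l' m'
    proof (rule ccontr)
      assume "\<not> adj G v m'"
      then have "t221 G a b v m' k l'"
        using d ab by (auto simp: d21_def t221_def adj_commute)
      then show False using assms(6) by blast
    qed
    have k: "adj G v k" if "adj G v l" "adj G v m"
      using that ab four[of a k l b a k m b a k l v a k m v] D v by (auto simp: d21_def switch_simps)
    have lm: "adj G v l \<or> adj G v m" if "adj G v k"
      using that ab four[of a k l b a k m b b l k v b m k v] D v by (auto simp: d21_def switch_simps)
    have swap: "v \<notin> {a, b, k, m, l}" using v by auto
    show ?thesis
      using single[OF D v(1)] single[OF D' swap] two[OF D v(1)] two[OF D' swap] k lm ab by auto
  qed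
qed

text \<open>\<open>D\<^sub>2\<^sub>1\<close> has two switches, and a wrong relation between two uniform vertices adds at least two more, so here
no further six-vertex graph arises.\<close>

lemma d21_grow:
  assumes "simple_graph G" "switch_degree G \<le> 3" "d21 G a b k l m"
    and "\<nexists>a b k l m n. d31 G a b k l m n"
    and "\<nexists>a b c k l m. t221 G a b c k l m" "\<nexists>a b c k l m. t221 (complement G) a b c k l m"
  shows "verts G = {a, b, k, l, m} \<or> decomposable G"
proof -
  note four = not_four_switches[OF assms(1,2)]
  show ?thesis
  proof (rule decomposable_of_uniform[where K = "{k, l, m}" and I = "{a, b}"])
    show "simple_graph G" by (rule assms(1))
    show "{a, b, k, l, m} = {k, l, m} \<union> {a, b}" by blast
    show "{a, b, k, l, m} \<subseteq> verts G" using d21_verts[OF assms(1,3)] .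
    show "(\<forall>w\<in>{a, b, k, l, m}. adj G v w) \<or> (\<forall>w\<in>{k, l, m}. adj G v w) \<and> (\<forall>w\<in>{a, b}. \<not> adj G v w) \<or>
        (\<forall>w\<in>{a, b, k, l, m}. \<not> adj G v w)" if "v \<in> verts G - {a, b, k, l, m}" for v
      using d21_neighbour[OF assms(1-3) that assms(4-6)] .
    show "adj G u v" if "u \<in> verts G - {a, b, k, l, m}" "v \<in> verts G - {a, b, k, l, m}" "u \<noteq> v"
      "\<forall>w\<in>{a, b, k, l, m}. adj G u w" "\<forall>w\<in>{k, l, m}. adj G v w" for u v
      using four[of a k l b a k m b a u l v a u m v] assms(3) that by (auto simp: d21_def switch_simps)
    show "\<not> adj G u v" if "u \<in> verts G - {a, b, k, l, m}" "v \<in> verts G - {a, b, k, l, m}" "u \<noteq> v"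
      "\<forall>w\<in>{a, b, k, l, m}. \<not> adj G u w" "\<forall>w\<in>{a, b}. \<not> adj G v w" for u v
      using four[of a k l b a k m b a k v u b l v u] assms(3) that by (auto simp: d21_def switch_simps)
  qed (use assms(3) in \<open>auto simp: d21_def adj_commute adj_irrefl[OF assms(1)]\<close>)
qed

section \<open>Graphs of switch degree one, two and three\<close>

text \<open>These three upper bounds show that a graph of larger switch degree has vertices outside the
configuration.\<close>

lemma path4_only:
  assumes "simple_graph G" "path4 G p q r s" "verts G = {p, q, r, s}"
  shows "switch_degree G \<le> 1"
proof -
  have "two_switches G \<subseteq> {switch p q r s}"
  proof
    fix t assume "t \<in> two_switches G"
    then obtain a b x y where t: "t = switch a b x y" and sw: "switchable G a b x y"
      by (auto simp: two_switches_eq)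
    have "a \<in> {p, q, r, s}" "b \<in> {p, q, r, s}" "x \<in> {p, q, r, s}" "y \<in> {p, q, r, s}"
      using switchable_verts[OF assms(1) sw] assms(3) by simp_all
    then show "t \<in> {switch p q r s}"
      using sw assms(2) unfolding t
      by (elim insertE emptyE) (simp_all add: path4_def switch_simps)
  qed
  from card_mono[OF _ this] show ?thesis
    by (simp add: switch_degree_def)
qed

lemma two_edges_only:
  assumes "simple_graph G" "two_edges G p q r s" "verts G = {p, q, r, s}"
  shows "switch_degree G \<le> 2"
proof -
  have "two_switches G \<subseteq> {switch p q r s, switch p q s r}"
  proof
    fix t assume "t \<in> two_switches G"
    then obtain a b x y where t: "t = switch a b x y" and sw: "switchable G a b x y"
      by (auto simp: two_switches_eq)
    have "a \<in> {p, q, r, s}" "b \<in> {p, q, r, s}" "x \<in> {p, q, r, s}" "y \<in> {p, q, r, s}"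
      using switchable_verts[OF assms(1) sw] assms(3) by simp_all
    then show "t \<in> {switch p q r s, switch p q s r}"
      using sw assms(2) unfolding t
      by (elim insertE emptyE) (simp_all add: two_edges_def switch_simps)
  qed
  from card_mono[OF _ this] show ?thesis
    using card_insert_le_m1[of 2 "{switch p q s r}" "switch p q r s"] by (simp add: switch_degree_def)
qed

lemma d21_only:
  assumes "simple_graph G" "d21 G a b k l m" "verts G = {a, b, k, l, m}"
  shows "switch_degree G \<le> 2"
proof -
  have "two_switches G \<subseteq> {switch a k l b, switch a k m b}"
  proof
    fix t assume "t \<in> two_switches G"
    then obtain c d x y where t: "t = switch c d x y" and sw: "switchable G c d x y"
      by (auto simp: two_switches_eq)
    have "c \<in> {a, b, k, l, m}" "d \<in> {a, b, k, l, m}" "x \<in> {a, b, k, l, m}" "y \<in> {a, b, k, l, m}"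
      using switchable_verts[OF assms(1) sw] assms(3) by simp_all
    then show "t \<in> {switch a k l b, switch a k m b}"
      using sw assms(2) unfolding t
      by (elim insertE emptyE) (simp_all add: d21_def switch_simps)
  qed
  from card_mono[OF _ this] show ?thesis
    using card_insert_le_m1[of 2 "{switch a k m b}" "switch a k l b"] by (simp add: switch_degree_def)
qed

lemma two_edges_switches:
  assumes "two_edges G p q r s"
  shows "switchable G p q r s" "switchable G p q s r" "distinct [switch p q r s, switch p q s r]"
  using assms by (auto simp: two_edges_def switch_simps)

lemma path4_exhausts:
  assumes "simple_graph G" "active G" "switch_degree G = 1" "path4 G p q r s"
  shows "verts G = {p, q, r, s}"
proof -
  have "switchable G p q r s"
    using assms(4) by (simp add: path4_def switchable_iff)
  then show ?thesis
    using verts_of_all_switches[OF assms(1,2), of "[switch p q r s]"] assms(3)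
    by (simp add: switch_in_two_switches switch_support)
qed

lemma two_edges_exhaust:
  assumes "simple_graph G" "active G" "switch_degree G = 2" "two_edges G p q r s"
  shows "verts G = {p, q, r, s}"
  using verts_of_all_switches[OF assms(1,2), of "[switch p q r s, switch p q s r]"]
    two_edges_switches[OF assms(4)] assms(3)
  by (auto simp: switch_in_two_switches switch_support)

lemma d21_exhausts:
  assumes "simple_graph G" "active G" "switch_degree G = 2" "d21 G a b k l m"
  shows "verts G = {a, b, k, l, m}"
  using verts_of_all_switches[OF assms(1,2), of "[switch a k l b, switch a k m b]"]
    d21_switches[OF assms(4)] assms(3)
  by (auto simp: switch_in_two_switches switch_support)

lemma three_switches_exhaust:
  assumes "simple_graph G" "active G" "switch_degree G = 3"
    and "switchable G a b x y" "switchable G a' b' x' y'" "switchable G a'' b'' x'' y''"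
    and "distinct [switch a b x y, switch a' b' x' y', switch a'' b'' x'' y'']"
  shows "verts G = {a, b, x, y} \<union> {a', b', x', y'} \<union> {a'', b'', x'', y''}"
  using verts_of_all_switches[OF assms(1,2), of "[switch a b x y, switch a' b' x' y', switch a'' b'' x'' y'']"]
    assms(3-) by (simp add: switch_in_two_switches switch_support Un_assoc)

lemma d31_exhausts:
  assumes "simple_graph G" "active G" "switch_degree G = 3" "d31 G a b k l m n"
  shows "verts G = {a, b, k, l, m, n}"
proof -
  have "verts G = {a, k, l, b} \<union> {a, k, m, b} \<union> {a, k, n, b}"
    using assms(4) by (intro three_switches_exhaust[OF assms(1-3)]) (auto simp: d31_def switch_simps)
  then show ?thesis by auto
qed

lemma t111_exhausts:
  assumes "simple_graph G" "active G" "switch_degree G = 3" "t111 G a b c k l m"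
  shows "verts G = {a, b, c, k, l, m}"
proof -
  have "verts G = {a, k, l, b} \<union> {a, k, m, c} \<union> {b, l, m, c}"
    using assms(4) by (intro three_switches_exhaust[OF assms(1-3)]) (auto simp: t111_def switch_simps)
  then show ?thesis by auto
qed

lemma t221_exhausts:
  assumes "simple_graph G" "active G" "switch_degree G = 3" "t221 G a b c k l m"
  shows "verts G = {a, b, c, k, l, m}"
proof -
  have "verts G = {a, l, k, b} \<union> {a, l, m, b} \<union> {b, k, l, c}"
    using assms(4) by (intro three_switches_exhaust[OF assms(1-3)]) (auto simp: t221_def switch_simps)
  then show ?thesis by auto
qed

lemma exists_switch:
  assumes "simple_graph G" "active G"
  obtains a b x y where "switchable G a b x y"
proof -
  obtain v where "v \<in> verts G"
    using assms(1) by (auto simp: simple_graph_def)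
  then show thesis
    using assms(2) that unfolding active_def active_vertex_def by meson
qed

lemma two_edges_degree:
  assumes "simple_graph G" "two_edges G p q r s"
  shows "switch_degree G \<ge> 2"
  using length_switches_le[OF assms(1), of "[switch p q r s, switch p q s r]"] two_edges_switches[OF assms(2)]
  by (auto simp: switch_in_two_switches)

theorem classify_degree_1:
  assumes "simple_graph G" "active G" "switch_degree G = 1"
  obtains p q r s where "path4 G p q r s" "verts G = {p, q, r, s}"
proof -
  obtain a b x y where "switchable G a b x y"
    using exists_switch[OF assms(1,2)] .
  then show thesis
    using assms(1)
  proof (cases rule: switchable_cases[OF assms(1), consumes 1])
    case (1 p q r s)
    then show thesis using that path4_exhausts[OF assms] by blast
  next
    case (2 p q r s)
    then show thesis using two_edges_degree[OF assms(1)] assms(3) by fastforce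
  next
    case (3 p q r s)
    then show thesis
      using two_edges_degree[OF simple_complement[OF assms(1)]] switch_degree_complement[OF assms(1)] assms(3)
      by fastforce
  qed
qed

lemma t111_degree:
  assumes "simple_graph G" "t111 G a b c k l m"
  shows "switch_degree G \<ge> 3"
proof -
  have "switchable G a k l b" "switchable G a k m c" "switchable G b l m c"
    "distinct [switch a k l b, switch a k m c, switch b l m c]"
    using assms(2) by (auto simp: t111_def switch_simps)
  then show ?thesis
    using length_switches_le[OF assms(1), of "[switch a k l b, switch a k m c, switch b l m c]"]
    by (auto simp: switch_in_two_switches)
qed

text \<open>A path cannot be the whole graph, and both six-vertex outcomes that involve \<open>T\<^sub>1\<^sub>1\<^sub>1\<close> need three
switches; so a path extends to \<open>D\<^sub>2\<^sub>1\<close> or its complement.\<close>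

theorem classify_degree_2:
  assumes "simple_graph G" "active G" "switch_degree G = 2" "\<not> decomposable G"
  obtains p q r s where "two_edges G p q r s" "verts G = {p, q, r, s}"
    | p q r s where "two_edges (complement G) p q r s" "verts G = {p, q, r, s}"
    | a b k l m where "d21 G a b k l m" "verts G = {a, b, k, l, m}"
    | a b k l m where "d21 (complement G) a b k l m" "verts G = {a, b, k, l, m}"
proof -
  note co = simple_complement[OF assms(1)] active_complement[OF assms(1,2)]
    switch_degree_complement[OF assms(1), unfolded assms(3)]
  obtain a b x y where "switchable G a b x y"
    using exists_switch[OF assms(1,2)] .
  then show thesis
  proof (cases rule: switchable_cases[OF assms(1), consumes 1])
    case (1 p q r s)
    have "\<nexists>a b c k l m. t111 G a b c k l m" "\<nexists>a b c k l m. t111 (complement G) a b c k l m"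
      using t111_degree[OF assms(1)] t111_degree[OF co(1)] co(3) assms(3) by fastforce+
    moreover have "verts G \<noteq> {p, q, r, s}"
      using path4_only[OF assms(1) 1] assms(3) by auto
    ultimately have "(\<exists>a b k l m. d21 G a b k l m) \<or> (\<exists>a b k l m. d21 (complement G) a b k l m)"
      using path4_grow[OF assms(1) _ 1] assms(3,4) by auto
    then show thesis
      using that(3) that(4) d21_exhausts[OF assms(1-3)] d21_exhausts[OF co] by fastforce
  next
    case (2 p q r s)
    then show thesis using that(1) two_edges_exhaust[OF assms(1-3)] by blast
  next
    case (3 p q r s)
    then show thesis using that(2) two_edges_exhaust[OF co] by fastforce
  qed
qed

text \<open>The initial four-set and also \<open>D\<^sub>2\<^sub>1\<close> have too few switches to be the whole graph, so the growth lemmas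
lead to a six-vertex configuration, in the graph or in its complement.\<close>

theorem classify_degree_3:
  assumes "simple_graph G" "active G" "switch_degree G = 3" "\<not> decomposable G"
  obtains X where "X = G \<or> X = complement G"
    "(\<exists>a b c k l m. t111 X a b c k l m) \<or> (\<exists>a b k l m n. d31 X a b k l m n) \<or>
     (\<exists>a b c k l m. t221 X a b c k l m)"
proof -
  note result = that
  have grow_d21: thesis if X: "X = G \<or> X = complement G" and d21: "d21 X a b k l m" for X a b k l m
  proof -
    have co: "simple_graph X" "switch_degree X = 3" "\<not> decomposable X"
      using X simple_complement[OF assms(1)] switch_degree_complement[OF assms(1)] assms
        decomposable_complement[OF assms(1)] by auto
    have "complement X = G \<or> complement X = complement G"
      using X complement_complement[OF assms(1)] by auto
    moreover have "verts X \<noteq> {a, b, k, l, m}"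
      using d21_only[OF co(1) d21] co(2) by auto
    moreover have "switch_degree X \<le> 3"
      using co(2) by simp
    ultimately show thesis
      using result[of X] result[of "complement X"] X d21_grow[OF co(1) _ d21] co(3) by metis
  qed
  have deg_co: "switch_degree (complement G) = 3"
    using switch_degree_complement[OF assms(1)] assms(3) by simp
  obtain a b x y where "switchable G a b x y"
    using exists_switch[OF assms(1,2)] .
  then show thesis
  proof (cases rule: switchable_cases[OF assms(1), consumes 1])
    case (1 p q r s)
    have "verts G \<noteq> {p, q, r, s}"
      using path4_only[OF assms(1) 1] assms(3) by auto
    moreover have "switch_degree G \<le> 3"
      using assms(3) by simp
    ultimately consider "\<exists>a b k l m. d21 G a b k l m" | "\<exists>a b k l m. d21 (complement G) a b k l m"
      | "\<exists>a b c k l m. t111 G a b c k l m" | "\<exists>a b c k l m. t111 (complement G) a b c k l m"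
      using path4_grow[OF assms(1) _ 1] assms(4) by metis
    then show thesis
    proof cases
      case 1
      then show thesis using grow_d21[of G] by metis
    next
      case 2
      then show thesis using grow_d21[of "complement G"] by metis
    next
      case 3
      then show thesis using result[of G] by simp
    next
      case 4
      then show thesis using result[of "complement G"] by simp
    qed
  next
    case (2 p q r s)
    then show thesis
      using two_edges_only[OF assms(1) 2] two_edges_grow[OF assms(1) _ 2] assms(3,4) by auto
  next
    case (3 p q r s)
    then show thesis
      using two_edges_only[OF simple_complement[OF assms(1)] 3] deg_co assms(4)
        two_edges_grow[OF simple_complement[OF assms(1)] _ 3] decomposable_complement[OF assms(1)] by auto
  qed
qed

section \<open>Isomorphisms and compositions\<close>

definition iso_map :: "('a \<Rightarrow> 'b) \<Rightarrow> 'a graph \<Rightarrow> 'b graph \<Rightarrow> bool" where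
  "iso_map f G H \<longleftrightarrow> bij_betw f (verts G) (verts H) \<and>
     (\<forall>u \<in> verts G. \<forall>v \<in> verts G. adj G u v \<longleftrightarrow> adj H (f u) (f v))"

lemma graph_iso_iff: "G \<cong> H \<longleftrightarrow> (\<exists>f. iso_map f G H)"
  by (simp add: graph_iso_def iso_map_def adj_def)

text \<open>Isomorphisms onto the named graphs are given by listing corresponding vertices. The list equation
records where the map sends each vertex, and hence the images of clique and independent set.\<close>

lemma iso_map_of_lists:
  assumes "distinct xs" "distinct ys" "length xs = length ys" "verts G = set xs" "verts H = set ys"
    and "\<forall>i < length xs. \<forall>j < length xs. adj G (xs ! i) (xs ! j) \<longleftrightarrow> adj H (ys ! i) (ys ! j)"
  obtains f where "iso_map f G H" "map f xs = ys"
proof -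
  define f where "f x = the (map_of (zip xs ys) x)" for x
  have nth: "f (xs ! i) = ys ! i" if "i < length xs" for i
    using assms(1,3) that by (simp add: f_def map_of_zip_nth)
  have map: "map f xs = ys"
    using assms(3) by (intro nth_equalityI) (simp_all add: nth)
  have "inj_on f (set xs)"
    using assms(2) unfolding map[symmetric] distinct_map by blast
  moreover have "f ` set xs = set ys"
    unfolding map[symmetric] by simp
  ultimately have "bij_betw f (verts G) (verts H)"
    unfolding assms(4,5) by (simp add: bij_betw_def)
  moreover have "adj G u v \<longleftrightarrow> adj H (f u) (f v)" if uv: "u \<in> verts G" "v \<in> verts G" for u v
  proof -
    obtain i j where "i < length xs" "xs ! i = u" "j < length xs" "xs ! j = v"
      using uv unfolding assms(4) in_set_conv_nth by blast
    then show ?thesis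
      using assms(6) nth by metis
  qed
  ultimately have "iso_map f G H"
    unfolding iso_map_def by blast
  then show thesis
    using that map by blast
qed

lemma iso_map_complement:
  assumes "simple_graph G" "simple_graph H" "iso_map f (complement G) H"
  shows "iso_map f G (complement H)"
  unfolding iso_map_def
proof (intro conjI ballI)
  have bij: "bij_betw f (verts G) (verts H)"
    using assms(3) by (simp add: iso_map_def)
  then show "bij_betw f (verts G) (verts (complement H))" by simp
  fix u v assume uv: "u \<in> verts G" "v \<in> verts G"
  then have "f u \<in> verts H" "f v \<in> verts H" "f u = f v \<longleftrightarrow> u = v"
    using bij by (auto simp: bij_betw_def inj_on_def)
  moreover have "adj (complement G) u v \<longleftrightarrow> adj H (f u) (f v)"
    using assms(3) uv by (simp add: iso_map_def)
  ultimately show "adj G u v \<longleftrightarrow> adj (complement H) (f u) (f v)"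
    using uv adj_irrefl[OF assms(1)] by auto
qed

lemma adj_map_graph:
  assumes "inj f"
  shows "adj (map_graph f G) (f u) (f v) \<longleftrightarrow> adj G u v"
proof -
  have "{f u, f v} = f ` e \<longleftrightarrow> {u, v} = e" for e
    using inj_image_eq_iff[OF assms, of "{u, v}" e] by simp
  then show ?thesis
    by (auto simp: adj_def map_graph_def image_iff)
qed

lemma adj_map_graph_range: "adj (map_graph f G) x y \<Longrightarrow> x \<in> range f \<and> y \<in> range f"
  by (auto simp: adj_def map_graph_def)

lemma adj_compose:
  "adj (S \<odot> H) (Inl u) (Inl v) \<longleftrightarrow> adj (graph_of S) u v"
  "adj (S \<odot> H) (Inr x) (Inr y) \<longleftrightarrow> adj H x y"
  "adj (S \<odot> H) (Inl u) (Inr x) \<longleftrightarrow> u \<in> clique S \<and> x \<in> verts H"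
  "adj (S \<odot> H) (Inr x) (Inl u) \<longleftrightarrow> u \<in> clique S \<and> x \<in> verts H"
proof -
  have maps: "graph_of (map_split Inl S) = map_graph Inl (graph_of S)" "clique (map_split Inl S) = Inl ` clique S"
    "verts (map_graph Inr H) = Inr ` verts H"
    by (simp_all add: map_split_def map_graph_def)
  note adj = compose_def adj_tyshkevich maps
  have no: "\<not> adj (map_graph Inl (graph_of S)) (Inr x) y" "\<not> adj (map_graph Inl (graph_of S)) y (Inr x)"
    "\<not> adj (map_graph Inr H) (Inl u) z" "\<not> adj (map_graph Inr H) z (Inl u)" for x y u z
    using adj_map_graph_range by fastforce+
  show "adj (S \<odot> H) (Inl u) (Inl v) \<longleftrightarrow> adj (graph_of S) u v"
    by (auto simp: adj no adj_map_graph)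
  show "adj (S \<odot> H) (Inr x) (Inr y) \<longleftrightarrow> adj H x y"
    by (auto simp: adj no adj_map_graph)
  show "adj (S \<odot> H) (Inl u) (Inr x) \<longleftrightarrow> u \<in> clique S \<and> x \<in> verts H"
    by (auto simp: adj no)
  show "adj (S \<odot> H) (Inr x) (Inl u) \<longleftrightarrow> u \<in> clique S \<and> x \<in> verts H"
    by (auto simp: adj no)
qed

lemma verts_compose: "verts (S \<odot> H) = verts (graph_of S) <+> verts H"
  by (simp add: compose_def tyshkevich_def map_split_def map_graph_def Plus_def)

text \<open>Isomorphisms of the two factors glue to an isomorphism of the composition as soon as the left one maps
the clique onto the clique, because the clique alone determines the edges between the factors.\<close>

lemma compose_iso:
  assumes dec: "decomposition G K I M"
    and f: "iso_map f (induced G (K \<union> I)) (graph_of S)" "f ` K = clique S"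
    and "induced G M \<cong> H"
  shows "G \<cong> S \<odot> H"
proof -
  obtain g where g: "iso_map g (induced G M) H"
    using assms(4) by (auto simp: graph_iso_iff)
  have V: "verts G = K \<union> I \<union> M" and disj: "K \<inter> I = {}" "(K \<union> I) \<inter> M = {}"
    using dec by (simp_all add: decomposition_def)
  have cross: "adj G x y \<longleftrightarrow> x \<in> K" "adj G y x \<longleftrightarrow> x \<in> K" if "x \<in> K \<union> I" "y \<in> M" for x y
    using dec that by (auto simp: decomposition_def adj_commute)
  have f_bij: "bij_betw f (K \<union> I) (verts (graph_of S))" and g_bij: "bij_betw g M (verts H)"
    and f_adj: "\<And>u v. u \<in> K \<union> I \<Longrightarrow> v \<in> K \<union> I \<Longrightarrow> adj G u v \<longleftrightarrow> adj (graph_of S) (f u) (f v)"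
    and g_adj: "\<And>u v. u \<in> M \<Longrightarrow> v \<in> M \<Longrightarrow> adj G u v \<longleftrightarrow> adj H (g u) (g v)"
    using f(1) g by (simp_all add: iso_map_def)
  have clique: "f u \<in> clique S \<longleftrightarrow> u \<in> K" if "u \<in> K \<union> I" for u
    using f(2) inj_onD[OF bij_betw_imp_inj_on[OF f_bij]] that by blast
  define h where "h x = (if x \<in> K \<union> I then Inl (f x) else Inr (g x))" for x
  have hS: "h x = Inl (f x)" if "x \<in> K \<union> I" for x using that by (simp add: h_def)
  have hH: "h x = Inr (g x)" if "x \<in> M" for x using that disj(2) by (auto simp: h_def)
  have bS: "bij_betw h (K \<union> I) (Inl ` verts (graph_of S))"
  proof -
    have "bij_betw (Inl \<circ> f) (K \<union> I) (Inl ` verts (graph_of S))"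
      using bij_betw_trans[OF f_bij, of Inl] by (simp add: bij_betw_def)
    then show ?thesis by (rule bij_betw_cong[THEN iffD1, rotated]) (simp add: hS)
  qed
  have bH: "bij_betw h M (Inr ` verts H)"
  proof -
    have "bij_betw (Inr \<circ> g) M (Inr ` verts H)"
      using bij_betw_trans[OF g_bij, of Inr] by (simp add: bij_betw_def)
    then show ?thesis by (rule bij_betw_cong[THEN iffD1, rotated]) (simp add: hH)
  qed
  have "bij_betw h (verts G) (verts (S \<odot> H))"
    unfolding V verts_compose Plus_def by (rule bij_betw_combine[OF bS bH]) auto
  moreover have "adj G u v \<longleftrightarrow> adj (S \<odot> H) (h u) (h v)" if uv: "u \<in> verts G" "v \<in> verts G" for u v
  proof -
    have gM: "g x \<in> verts H" if "x \<in> M" for x using g_bij that by (auto simp: bij_betw_def)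
    consider "u \<in> K \<union> I" "v \<in> K \<union> I" | "u \<in> M" "v \<in> M" | "u \<in> K \<union> I" "v \<in> M" | "u \<in> M" "v \<in> K \<union> I"
      using uv unfolding V by blast
    then show ?thesis
    proof cases
      case 1
      then show ?thesis using f_adj by (simp only: hS adj_compose)
    next
      case 2
      then show ?thesis using g_adj by (simp only: hH adj_compose)
    next
      case 3
      then show ?thesis using cross(1)[OF 3] clique[OF 3(1)] gM by (simp only: hS hH adj_compose) blast
    next
      case 4
      then show ?thesis using cross(2)[OF 4(2,1)] clique[OF 4(2)] gM by (simp only: hS hH adj_compose) blast
    qed
  qed
  ultimately show ?thesis
    unfolding graph_iso_iff iso_map_def by blast
qed

section \<open>The named graphs\<close>

lemma adj_split_from:
  "adj (graph_of (split_from K I N)) (Inl u) (Inl v) \<longleftrightarrow> u \<in> K \<and> v \<in> K \<and> u \<noteq> v"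
  "adj (graph_of (split_from K I N)) (Inr i) (Inl u) \<longleftrightarrow> i \<in> I \<and> u \<in> N i"
  "adj (graph_of (split_from K I N)) (Inl u) (Inr i) \<longleftrightarrow> i \<in> I \<and> u \<in> N i"
  "\<not> adj (graph_of (split_from K I N)) (Inr i) (Inr j)"
  by (auto simp: adj_def split_from_def doubleton_eq_iff)

lemma verts_split_from: "verts (graph_of (split_from K I N)) = Inl ` K \<union> Inr ` I"
  by (simp add: split_from_def)

lemma simple_split_from:
  assumes "finite K" "finite I" "K \<noteq> {}" "\<And>i. i \<in> I \<Longrightarrow> N i \<subseteq> K"
  shows "simple_graph (graph_of (split_from K I N))"
proof -
  have "{Inr i, Inl k} \<in> {{u, v} | u v. u \<in> Inl ` K \<union> Inr ` I \<and> v \<in> Inl ` K \<union> Inr ` I \<and> u \<noteq> v}"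
    if "i \<in> I" "k \<in> N i" for i k
    using that assms(4) by (intro CollectI exI[of _ "Inr i"] exI[of _ "Inl k"]) auto
  moreover have "{Inl u, Inl v} \<in> {{u, v} | u v. u \<in> Inl ` K \<union> Inr ` I \<and> v \<in> Inl ` K \<union> Inr ` I \<and> u \<noteq> v}"
    if "u \<in> K" "v \<in> K" "u \<noteq> v" for u v
    using that by (intro CollectI exI[of _ "Inl u"] exI[of _ "Inl v"]) auto
  ultimately show ?thesis
    using assms(1-3) by (auto simp: simple_graph_def split_from_def)
qed

lemma is_split_split_from: "is_split (graph_of (split_from K I N))"
proof -
  have "split_bipartition (graph_of (split_from K I N)) (Inl ` K) (Inr ` I)"
    unfolding split_bipartition_def adj_def[symmetric]
    by (auto simp: adj_split_from) (auto simp: split_from_def)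
  then show ?thesis by (auto simp: is_split_def)
qed

lemma is_split_complement: "is_split G \<Longrightarrow> is_split (complement G)"
proof -
  assume "is_split G"
  then obtain K I where "split_bipartition G K I" by (auto simp: is_split_def)
  then have "split_bipartition (complement G) I K"
    unfolding split_bipartition_def adj_def[symmetric] by auto
  then show ?thesis by (auto simp: is_split_def)
qed

lemma simple_named: "simple_graph (graph_of D21)" "simple_graph (graph_of D31)"
  "simple_graph (graph_of T111)" "simple_graph (graph_of T221)"
  unfolding D21_def D31_def T111_def T221_def by (rule simple_split_from; auto)+

lemma simple_two_K2: "simple_graph two_K2"
proof -
  have "{0, 1} \<in> {{u, v} | u v. u \<in> {0, 1, 2, 3::nat} \<and> v \<in> {0, 1, 2, 3} \<and> u \<noteq> v}"
    "{2, 3} \<in> {{u, v} | u v. u \<in> {0, 1, 2, 3::nat} \<and> v \<in> {0, 1, 2, 3} \<and> u \<noteq> v}"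
    by (intro CollectI exI conjI, rule refl, simp_all)+
  then show ?thesis by (simp add: simple_graph_def two_K2_def)
qed

lemma path4_iso:
  assumes "simple_graph G" "path4 G p q r s" "verts G = {p, q, r, s}"
  obtains f where "iso_map f G (graph_of P4)" "f ` {q, r} = clique P4"
proof (rule iso_map_of_lists[of "[p, q, r, s]" "[0, 1, 2, 3]" G "graph_of P4"])
  show "\<forall>i<length [p, q, r, s]. \<forall>j<length [p, q, r, s].
      adj G ([p, q, r, s] ! i) ([p, q, r, s] ! j) \<longleftrightarrow> adj (graph_of P4) ([0, 1, 2, 3] ! i) ([0, 1, 2, 3] ! j)"
    using assms(2) adj_irrefl[OF assms(1)]
    by (simp add: All_less_Suc path4_def adj_commute) (simp add: adj_def P4_def doubleton_eq_iff)
qed (use assms that in \<open>auto simp: path4_def P4_def\<close>)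

lemma two_edges_iso:
  assumes "simple_graph G" "two_edges G p q r s" "verts G = {p, q, r, s}"
  shows "\<exists>f. iso_map f G two_K2"
proof (rule iso_map_of_lists[of "[p, q, r, s]" "[0, 1, 2, 3]" G two_K2])
  show "\<forall>i<length [p, q, r, s]. \<forall>j<length [p, q, r, s].
      adj G ([p, q, r, s] ! i) ([p, q, r, s] ! j) \<longleftrightarrow> adj two_K2 ([0, 1, 2, 3] ! i) ([0, 1, 2, 3] ! j)"
    using assms(2) adj_irrefl[OF assms(1)]
    by (simp add: All_less_Suc two_edges_def adj_commute) (simp add: adj_def two_K2_def doubleton_eq_iff)
qed (use assms in \<open>auto simp: two_edges_def two_K2_def\<close>)

lemma complement_two_K2: "complement two_K2 \<cong> C4"
proof -
  have "\<exists>f. iso_map f (complement two_K2) C4"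
  proof (rule iso_map_of_lists[of "[0, 2, 1, 3]" "[0, 1, 2, 3]" "complement two_K2" C4])
    show "\<forall>i<length [0::nat, 2, 1, 3]. \<forall>j<length [0::nat, 2, 1, 3].
      adj (complement two_K2) ([0, 2, 1, 3] ! i) ([0, 2, 1, 3] ! j) \<longleftrightarrow> adj C4 ([0, 1, 2, 3] ! i) ([0, 1, 2, 3] ! j)"
      by (simp add: All_less_Suc) (simp add: adj_def two_K2_def C4_def doubleton_eq_iff)
  qed (auto simp: two_K2_def C4_def)
  then show ?thesis by (simp add: graph_iso_iff)
qed

lemma d21_iso:
  assumes "simple_graph G" "d21 G a b k l m" "verts G = {a, b, k, l, m}"
  obtains (obtained) f where "iso_map f G (graph_of D21)" "f ` {k, l, m} = clique D21" "f ` {a, b} = indep D21"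
proof (rule iso_map_of_lists[of "[k, l, m, a, b]" "[Inl 1, Inl 2, Inl 3, Inr CHR ''a'', Inr CHR ''b'']" G "graph_of D21"])
  show "\<forall>i<length [k, l, m, a, b]. \<forall>j<length [k, l, m, a, b].
      adj G ([k, l, m, a, b] ! i) ([k, l, m, a, b] ! j) \<longleftrightarrow>
      adj (graph_of D21) ([Inl 1, Inl 2, Inl 3, Inr CHR ''a'', Inr CHR ''b''] ! i)
        ([Inl 1, Inl 2, Inl 3, Inr CHR ''a'', Inr CHR ''b''] ! j)"
    using assms(2) adj_irrefl[OF assms(1)]
    by (simp add: All_less_Suc d21_def adj_commute[of G]) (simp add: D21_def adj_split_from)
  show thesis if "iso_map f G (graph_of D21)"
    "map f [k, l, m, a, b] = [Inl 1, Inl 2, Inl 3, Inr CHR ''a'', Inr CHR ''b'']" for f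
  proof (rule obtained[OF that(1)])
    have "clique D21 = Inl ` {1, 2, 3}" "indep D21 = Inr ` {CHR ''a'', CHR ''b''}"
      by (simp_all only: D21_def split_from_def split_triple.simps)
    then show "f ` {k, l, m} = clique D21" "f ` {a, b} = indep D21"
      using that(2) by simp_all
  qed
qed (use assms in \<open>auto simp: d21_def D21_def verts_split_from\<close>)

lemma d31_iso:
  assumes "simple_graph G" "d31 G a b k l m n" "verts G = {a, b, k, l, m, n}"
  shows "\<exists>f. iso_map f G (graph_of D31)"
proof (rule iso_map_of_lists[of "[k, l, m, n, a, b]"
      "[Inl 1, Inl 2, Inl 3, Inl 4, Inr CHR ''a'', Inr CHR ''b'']" G "graph_of D31"])
  show "\<forall>i<length [k, l, m, n, a, b]. \<forall>j<length [k, l, m, n, a, b].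
      adj G ([k, l, m, n, a, b] ! i) ([k, l, m, n, a, b] ! j) \<longleftrightarrow>
      adj (graph_of D31) ([Inl 1, Inl 2, Inl 3, Inl 4, Inr CHR ''a'', Inr CHR ''b''] ! i)
        ([Inl 1, Inl 2, Inl 3, Inl 4, Inr CHR ''a'', Inr CHR ''b''] ! j)"
    using assms(2) adj_irrefl[OF assms(1)]
    by (simp add: All_less_Suc d31_def adj_commute[of G]) (simp add: D31_def adj_split_from)
  show "\<exists>f. iso_map f G (graph_of D31)" if "iso_map f G (graph_of D31)" for f
    using that by blast
qed (use assms in \<open>auto simp: d31_def D31_def verts_split_from\<close>)

lemma t111_iso:
  assumes "simple_graph G" "t111 G a b c k l m" "verts G = {a, b, c, k, l, m}"
  shows "\<exists>f. iso_map f G (graph_of T111)"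
proof (rule iso_map_of_lists[of "[k, l, m, a, b, c]"
      "[Inl 1, Inl 2, Inl 3, Inr CHR ''a'', Inr CHR ''b'', Inr CHR ''c'']" G "graph_of T111"])
  show "\<forall>i<length [k, l, m, a, b, c]. \<forall>j<length [k, l, m, a, b, c].
      adj G ([k, l, m, a, b, c] ! i) ([k, l, m, a, b, c] ! j) \<longleftrightarrow>
      adj (graph_of T111) ([Inl 1, Inl 2, Inl 3, Inr CHR ''a'', Inr CHR ''b'', Inr CHR ''c''] ! i)
        ([Inl 1, Inl 2, Inl 3, Inr CHR ''a'', Inr CHR ''b'', Inr CHR ''c''] ! j)"
    using assms(2) adj_irrefl[OF assms(1)]
    by (simp add: All_less_Suc t111_def adj_commute[of G]) (simp add: T111_def adj_split_from)
  show "\<exists>f. iso_map f G (graph_of T111)" if "iso_map f G (graph_of T111)" for f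
    using that by blast
qed (use assms in \<open>auto simp: t111_def T111_def verts_split_from\<close>)

lemma t221_iso:
  assumes "simple_graph G" "t221 G a b c k l m" "verts G = {a, b, c, k, l, m}"
  shows "\<exists>f. iso_map f G (graph_of T221)"
proof (rule iso_map_of_lists[of "[k, l, m, a, b, c]"
      "[Inl 1, Inl 2, Inl 3, Inr CHR ''a'', Inr CHR ''b'', Inr CHR ''c'']" G "graph_of T221"])
  show "\<forall>i<length [k, l, m, a, b, c]. \<forall>j<length [k, l, m, a, b, c].
      adj G ([k, l, m, a, b, c] ! i) ([k, l, m, a, b, c] ! j) \<longleftrightarrow>
      adj (graph_of T221) ([Inl 1, Inl 2, Inl 3, Inr CHR ''a'', Inr CHR ''b'', Inr CHR ''c''] ! i)
        ([Inl 1, Inl 2, Inl 3, Inr CHR ''a'', Inr CHR ''b'', Inr CHR ''c''] ! j)"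
    using assms(2) adj_irrefl[OF assms(1)]
    by (simp add: All_less_Suc t221_def adj_commute[of G]) (simp add: T221_def adj_split_from)
  show "\<exists>f. iso_map f G (graph_of T221)" if "iso_map f G (graph_of T221)" for f
    using that by blast
qed (use assms in \<open>auto simp: t221_def T221_def verts_split_from\<close>)

section \<open>Factors of a decomposable graph\<close>

lemma graph_iso_trans:
  assumes "G \<cong> H" "H \<cong> J"
  shows "G \<cong> J"
proof -
  obtain f g where f: "iso_map f G H" and g: "iso_map g H J"
    using assms unfolding graph_iso_iff by blast
  have "iso_map (g \<circ> f) G J"
    unfolding iso_map_def
  proof (intro conjI ballI)
    show "bij_betw (g \<circ> f) (verts G) (verts J)"
      using f g bij_betw_trans by (auto simp: iso_map_def)
    fix u v assume uv: "u \<in> verts G" "v \<in> verts G"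
    then have "f u \<in> verts H" "f v \<in> verts H"
      using f by (auto simp: iso_map_def bij_betw_def)
    then show "adj G u v \<longleftrightarrow> adj J ((g \<circ> f) u) ((g \<circ> f) v)"
      using f g uv by (simp add: iso_map_def)
  qed
  then show ?thesis
    unfolding graph_iso_iff by blast
qed

lemma split_bipartition_iff:
  "split_bipartition G K I \<longleftrightarrow> K \<union> I = verts G \<and> K \<inter> I = {} \<and>
     (\<forall>u \<in> K. \<forall>v \<in> K. u \<noteq> v \<longrightarrow> adj G u v) \<and> (\<forall>u \<in> I. \<forall>v \<in> I. \<not> adj G u v)"
  by (simp add: split_bipartition_def adj_def)

lemma split_bipartition_complement:
  "split_bipartition G K I \<Longrightarrow> split_bipartition (complement G) I K"
  by (auto simp: split_bipartition_iff)

lemma split_bipartition_induced: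
  "split_bipartition G K I \<Longrightarrow> X \<subseteq> verts G \<Longrightarrow> split_bipartition (induced G X) (K \<inter> X) (I \<inter> X)"
  unfolding split_bipartition_iff by (simp, blast)

lemma decomposition_split:
  "decomposition G K I M \<Longrightarrow> split_bipartition (induced G (K \<union> I)) K I"
  by (simp add: decomposition_def split_bipartition_iff)

text \<open>Suppose that a vertex of an alternating 4-cycle lies in \<open>M\<close>. Its neighbour on the cycle is not in \<open>I\<close>
and its non-neighbour is not in \<open>K\<close>; continuing from these two around the cycle leaves only \<open>M\<close> for all
vertices. By symmetry the same holds for any starting vertex.\<close>

lemma decomposition_switchable:
  assumes "simple_graph G" "decomposition G K I M" "switchable G a b x y"
  shows "{a, b, x, y} \<subseteq> K \<union> I \<or> {a, b, x, y} \<subseteq> M"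
proof -
  have V: "verts G = K \<union> I \<union> M" and disj: "K \<inter> I = {}" "(K \<union> I) \<inter> M = {}"
    using assms(2) by (simp_all add: decomposition_def)
  have adj: "\<forall>u \<in> K. \<forall>v \<in> K. u \<noteq> v \<longrightarrow> adj G u v" "\<forall>u \<in> I. \<forall>v \<in> I. \<not> adj G u v"
    "\<forall>u \<in> K. \<forall>v \<in> M. adj G u v" "\<forall>u \<in> I. \<forall>v \<in> M. \<not> adj G u v"
    using assms(2) unfolding decomposition_def by simp_all
  have edge: "v \<notin> I \<and> v \<notin> M" if "adj G u v" "u \<in> I" for u v
    using that adj(2,4) by blast
  have non_edge: "v \<notin> K \<and> v \<notin> M" if "\<not> adj G u v" "u \<in> K" "u \<noteq> v" for u v
    using that adj(1,3) by blast
  have all_M: "b \<in> M \<and> x \<in> M \<and> y \<in> M" if sw: "switchable G a b x y" and a: "a \<in> M" for a b x y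
  proof -
    have ab: "adj G b a" "adj G x y" "adj G y x" "\<not> adj G x a" "\<not> adj G b y" "\<not> adj G y b"
      "a \<noteq> x" "b \<noteq> y"
      using sw by (simp_all add: switchable_iff adj_commute)
    have in_V: "b \<in> K \<or> b \<in> I \<or> b \<in> M" "x \<in> K \<or> x \<in> I \<or> x \<in> M" "y \<in> K \<or> y \<in> I \<or> y \<in> M"
      using switchable_verts[OF assms(1) sw] unfolding V by simp_all
    have "b \<notin> I" using edge[OF ab(1)] a by blast
    moreover have "x \<notin> K" using non_edge[OF ab(4)] ab(7) a by blast
    moreover have "y \<notin> I" using edge[OF ab(3)] in_V(2) \<open>x \<notin> K\<close> by blast
    moreover have "b \<notin> K" using non_edge[OF ab(5) _ ab(8)] in_V(3) \<open>y \<notin> I\<close> by blast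
    moreover have "y \<notin> K" using non_edge[OF ab(6) _ ab(8)[symmetric]] in_V(1) \<open>b \<notin> I\<close> by blast
    moreover have "x \<notin> I" using edge[OF ab(2)] in_V(3) \<open>y \<notin> K\<close> by blast
    ultimately show ?thesis using in_V by blast
  qed
  have sym: "switchable G b a y x" "switchable G x y a b" "switchable G y x b a"
    using assms(3) by (auto simp: switchable_iff adj_commute)
  show ?thesis
    using all_M[OF assms(3)] all_M[OF sym(1)] all_M[OF sym(2)] all_M[OF sym(3)]
      switchable_verts[OF assms(1,3), unfolded V] by blast
qed

text \<open>Since every switch lies in one factor, degrees add and both factors inherit activity; being nonempty
and active, each factor has a switch.\<close>

lemma decomposition_parts:
  assumes "simple_graph G" "active G" "decomposition G K I M"
  shows "simple_graph (induced G (K \<union> I))" "simple_graph (induced G M)"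
    "active (induced G (K \<union> I))" "active (induced G M)"
    "switch_degree G = switch_degree (induced G (K \<union> I)) + switch_degree (induced G M)"
    "switch_degree (induced G (K \<union> I)) > 0" "switch_degree (induced G M) > 0"
proof -
  let ?S = "induced G (K \<union> I)" and ?H = "induced G M"
  have V: "verts G = K \<union> I \<union> M" "(K \<union> I) \<inter> M = {}" "K \<union> I \<noteq> {}" "M \<noteq> {}"
    using assms(3) by (simp_all add: decomposition_def)
  show simple: "simple_graph ?S" "simple_graph ?H"
    using V by (auto intro!: simple_induced[OF assms(1)])
  have in_part: "switchable (induced G X) a b x y"
    if "switchable G a b x y" "{a, b, x, y} \<subseteq> X" for X a b x y
    using that by (simp add: switchable_induced)
  have part: "active (induced G X)" if X: "X = K \<union> I \<and> Y = M \<or> X = M \<and> Y = K \<union> I" for X Y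
    unfolding active_def active_vertex_def verts_induced
  proof
    fix v assume v: "v \<in> X"
    then obtain a b x y where sw: "switchable G a b x y" "v \<in> {a, b, x, y}"
      using assms(2) V(1) X unfolding active_def active_vertex_def by blast
    have "\<not> {a, b, x, y} \<subseteq> Y"
      using v sw(2) X V(2) by blast
    then have "{a, b, x, y} \<subseteq> X"
      using decomposition_switchable[OF assms(1,3) sw(1)] X by blast
    then show "\<exists>a b x y. switchable (induced G X) a b x y \<and> v \<in> {a, b, x, y}"
      using in_part[OF sw(1)] sw(2) by blast
  qed
  show active: "active ?S" "active ?H"
    using part by blast+
  have union: "two_switches G = two_switches ?S \<union> two_switches ?H"
  proof
    show "two_switches G \<subseteq> two_switches ?S \<union> two_switches ?H"
    proof
      fix t assume "t \<in> two_switches G"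
      then obtain a b x y where "t = switch a b x y" "switchable G a b x y"
        unfolding two_switches_eq by blast
      then show "t \<in> two_switches ?S \<union> two_switches ?H"
        using decomposition_switchable[OF assms(1,3), of a b x y] in_part[of a b x y]
          switch_in_two_switches[of ?S a b x y] switch_in_two_switches[of ?H a b x y] by blast
    qed
    show "two_switches ?S \<union> two_switches ?H \<subseteq> two_switches G"
      unfolding two_switches_eq switchable_induced by blast
  qed
  have support: "\<Union> (fst t) \<noteq> {} \<and> \<Union> (fst t) \<subseteq> X" if t: "t \<in> two_switches (induced G X)" for t X
  proof -
    obtain a b x y where "t = switch a b x y" "{a, b, x, y} \<subseteq> X"
      using t unfolding two_switches_eq switchable_induced by blast
    then show ?thesis
      using switch_support[of a b x y] by simp
  qed
  have "False" if "t \<in> two_switches ?S" "t \<in> two_switches ?H" for t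
  proof -
    have "\<Union> (fst t) \<subseteq> (K \<union> I) \<inter> M" "\<Union> (fst t) \<noteq> {}"
      using support[OF that(1)] support[OF that(2)] by simp_all
    then show False unfolding V(2) by simp
  qed
  then have "two_switches ?S \<inter> two_switches ?H = {}" by blast
  then show "switch_degree G = switch_degree ?S + switch_degree ?H"
    using card_Un_disjoint[OF finite_two_switches[OF simple(1)] finite_two_switches[OF simple(2)]]
    by (simp add: switch_degree_def union)
  have "switch_degree X > 0" if X: "simple_graph X" "active X" for X :: "'a graph"
  proof -
    obtain a b x y where "switchable X a b x y"
      using exists_switch[OF X] .
    then have "two_switches X \<noteq> {}"
      using switch_in_two_switches[of X a b x y] by force
    then show ?thesis
      using finite_two_switches[OF X(1)] by (simp add: switch_degree_def card_gt_0_iff)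
  qed
  then show "switch_degree ?S > 0" "switch_degree ?H > 0"
    using simple active by blast+
qed

section \<open>The classification\<close>

text \<open>In a split graph every edge meets the clique and every non-edge meets the independent set. Applied to all
pairs of a path, this leaves one bipartition; the same argument excludes \<open>2K\<^sub>2\<close> and fixes the bipartition
of \<open>D\<^sub>2\<^sub>1\<close>.\<close>

lemma path4_split_unique:
  assumes "path4 G p q r s" "split_bipartition G K I" "verts G = {p, q, r, s}"
  shows "K = {q, r}"
proof -
  have KI: "K \<union> I = {p, q, r, s}" "K \<inter> I = {}"
    using assms(2,3) by (simp_all add: split_bipartition_iff)
  have pairs: "adj G u v \<Longrightarrow> u \<in> K \<or> v \<in> K" "u \<noteq> v \<Longrightarrow> \<not> adj G u v \<Longrightarrow> u \<notin> K \<or> v \<notin> K"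
    if "u \<in> K \<union> I" "v \<in> K \<union> I" for u v
    using assms(2) that unfolding split_bipartition_iff by blast+
  have "q \<in> K \<and> r \<in> K \<and> p \<notin> K \<and> s \<notin> K"
    using pairs[of p q] pairs[of q r] pairs[of r s] pairs[of p r] pairs[of q s] pairs[of p s] assms(1)
    unfolding KI(1) path4_def by auto
  then show ?thesis using KI by auto
qed

lemma two_edges_not_split:
  assumes "two_edges G p q r s" "split_bipartition G K I" "verts G = {p, q, r, s}"
  shows False
proof -
  have pairs: "adj G u v \<Longrightarrow> u \<in> K \<or> v \<in> K" "u \<noteq> v \<Longrightarrow> \<not> adj G u v \<Longrightarrow> u \<notin> K \<or> v \<notin> K"
    if "u \<in> verts G" "v \<in> verts G" for u v
    using assms(2) that unfolding split_bipartition_iff by blast+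
  show False
    using pairs[of p q] pairs[of r s] pairs[of p r] pairs[of p s] pairs[of q r] pairs[of q s] assms(1)
    unfolding assms(3) two_edges_def by auto
qed

lemma d21_split_unique:
  assumes "d21 G a b k l m" "split_bipartition G K I" "verts G = {a, b, k, l, m}"
  shows "K = {k, l, m}" "I = {a, b}"
proof -
  have KI: "K \<union> I = {a, b, k, l, m}" "K \<inter> I = {}"
    using assms(2,3) by (simp_all add: split_bipartition_iff)
  have pairs: "adj G u v \<Longrightarrow> u \<in> K \<or> v \<in> K" "u \<noteq> v \<Longrightarrow> \<not> adj G u v \<Longrightarrow> u \<notin> K \<or> v \<notin> K"
    if "u \<in> K \<union> I" "v \<in> K \<union> I" for u v
    using assms(2) that unfolding split_bipartition_iff by blast+
  have "k \<in> K \<and> l \<in> K \<and> m \<in> K \<and> a \<notin> K \<and> b \<notin> K"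
    using pairs[of k l] pairs[of k m] pairs[of l m] pairs[of a k] pairs[of b l] pairs[of b m]
      pairs[of a b] pairs[of a l] pairs[of a m] pairs[of b k] assms(1)
    unfolding KI(1) d21_def by auto
  then show "K = {k, l, m}" "I = {a, b}" using KI by auto
qed

lemma degree_1_split:
  assumes "simple_graph G" "active G" "switch_degree G = 1" "split_bipartition G K I"
  shows "\<exists>f. iso_map f G (graph_of P4) \<and> f ` K = clique P4"
    and "split_bipartition G K' I' \<Longrightarrow> K' = K \<and> I' = I"
proof -
  obtain p q r s where P: "path4 G p q r s" "verts G = {p, q, r, s}"
    using classify_degree_1[OF assms(1-3)] .
  note K = path4_split_unique[OF P(1) _ P(2)]
  show "\<exists>f. iso_map f G (graph_of P4) \<and> f ` K = clique P4"
    using path4_iso[OF assms(1) P] K[OF assms(4)] by metis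
  have rest: "X = verts G - Y" if "split_bipartition G Y X" for X Y
    using that by (auto simp: split_bipartition_iff)
  show "split_bipartition G K' I' \<Longrightarrow> K' = K \<and> I' = I"
    using K[OF assms(4)] K[of K' I'] rest[OF assms(4)] rest[of K' I'] by simp
qed

lemma degree_1_iso:
  assumes "simple_graph G" "active G" "switch_degree G = 1"
  shows "G \<cong> graph_of P4"
  using classify_degree_1[OF assms] path4_iso[OF assms(1)] unfolding graph_iso_iff by metis

lemma degree_2_iso:
  assumes "simple_graph G" "active G" "switch_degree G = 2"
  shows "G \<cong> C4 \<or> G \<cong> two_K2 \<or> G \<cong> graph_of D21 \<or> G \<cong> complement (graph_of D21) \<or> G \<cong> P4 \<odot> graph_of P4"
proof (cases "decomposable G")
  case True
  then obtain K I M where dec: "decomposition G K I M"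
    using decomposable_iff_decomposition[OF assms(1)] by blast
  note parts = decomposition_parts[OF assms(1,2) dec]
  have deg: "switch_degree (induced G (K \<union> I)) = 1" "switch_degree (induced G M) = 1"
    using parts(5-7) assms(3) by linarith+
  obtain f where "iso_map f (induced G (K \<union> I)) (graph_of P4)" "f ` K = clique P4"
    using degree_1_split(1)[OF parts(1,3) deg(1) decomposition_split[OF dec]] by blast
  then show ?thesis
    using compose_iso[OF dec _ _ degree_1_iso[OF parts(2,4) deg(2)]] by blast
next
  case False
  note co = simple_complement[OF assms(1)]
  show ?thesis
  proof (rule classify_degree_2[OF assms False])
    fix p q r s assume "two_edges G p q r s" "verts G = {p, q, r, s}"
    then show ?thesis
      using two_edges_iso[OF assms(1)] unfolding graph_iso_iff by blast
  next
    fix p q r s assume te: "two_edges (complement G) p q r s" "verts G = {p, q, r, s}"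
    then obtain f where "iso_map f (complement G) two_K2"
      using two_edges_iso[OF co te(1)] by auto
    then have "G \<cong> complement two_K2"
      using iso_map_complement[OF assms(1) simple_two_K2] unfolding graph_iso_iff by blast
    then show ?thesis
      using graph_iso_trans complement_two_K2 by blast
  next
    fix a b k l m assume "d21 G a b k l m" "verts G = {a, b, k, l, m}"
    then show ?thesis
      using d21_iso[OF assms(1)] unfolding graph_iso_iff by metis
  next
    fix a b k l m assume "d21 (complement G) a b k l m" "verts G = {a, b, k, l, m}"
    then show ?thesis
      using d21_iso[OF co] iso_map_complement[OF assms(1) simple_named(1)]
      unfolding graph_iso_iff verts_complement by metis
  qed
qed

text \<open>One direction of associativity: if the left factor decomposes further, its own left factor can be split
off first. The inclusions say that the inner bipartition refines the outer one.\<close>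

lemma decomposition_assoc:
  assumes "decomposition G K I M" "decomposition (induced G (K \<union> I)) K' I' M'"
    and "K' \<subseteq> K" "I' \<subseteq> I"
  shows "decomposition G K' I' (M' \<union> M)"
proof -
  have sets: "verts G = K \<union> I \<union> M" "K \<inter> I = {}" "(K \<union> I) \<inter> M = {}" "M \<noteq> {}"
    and sets': "K \<union> I = K' \<union> I' \<union> M'" "K' \<inter> I' = {}" "(K' \<union> I') \<inter> M' = {}" "K' \<union> I' \<noteq> {}" "M' \<noteq> {}"
    using assms(1,2) by (simp_all add: decomposition_def)
  have M': "M' \<subseteq> K \<union> I"
    using sets'(1) by blast
  have adj: "\<forall>u \<in> K. \<forall>v \<in> K. u \<noteq> v \<longrightarrow> adj G u v" "\<forall>u \<in> I. \<forall>v \<in> I. \<not> adj G u v"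
    "\<forall>u \<in> K. \<forall>v \<in> M. adj G u v" "\<forall>u \<in> I. \<forall>v \<in> M. \<not> adj G u v"
    using assms(1) unfolding decomposition_def by simp_all
  have adj': "\<forall>u \<in> K'. \<forall>v \<in> M'. adj G u v" "\<forall>u \<in> I'. \<forall>v \<in> M'. \<not> adj G u v"
  proof -
    have "\<forall>u \<in> K'. \<forall>v \<in> M'. adj (induced G (K \<union> I)) u v"
      using assms(2) unfolding decomposition_def by simp
    then show "\<forall>u \<in> K'. \<forall>v \<in> M'. adj G u v" by simp
    have "\<forall>u \<in> I'. \<forall>v \<in> M'. \<not> adj (induced G (K \<union> I)) u v"
      using assms(2) unfolding decomposition_def by (elim conjE)
    then show "\<forall>u \<in> I'. \<forall>v \<in> M'. \<not> adj G u v"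
      using assms(4) M' by auto
  qed
  show "decomposition G K' I' (M' \<union> M)"
    unfolding decomposition_def
  proof (intro conjI ballI impI)
    show "verts G = K' \<union> I' \<union> (M' \<union> M)" using sets(1) sets'(1) by (simp add: Un_assoc)
    show "(K' \<union> I') \<inter> (M' \<union> M) = {}" using sets(3) sets'(1,3) by blast
    show "adj G u v" if "u \<in> K'" "v \<in> M' \<union> M" for u v using that adj(3) adj'(1) assms(3) by blast
    show "\<not> adj G u v" if "u \<in> I'" "v \<in> M' \<union> M" for u v using that adj(4) adj'(2) assms(4) by blast
    show "adj G u v" if "u \<in> K'" "v \<in> K'" "u \<noteq> v" for u v using that adj(1) assms(3) by blast
    show "\<not> adj G u v" if "u \<in> I'" "v \<in> I'" for u v using that adj(2) assms(4) by blast
  qed (use sets(4) sets' in simp_all)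
qed

text \<open>The split version of \<open>degree_2_iso\<close>: \<open>C\<^sub>4\<close> and \<open>2K\<^sub>2\<close> are not split, and the bipartition of \<open>D\<^sub>2\<^sub>1\<close> is unique,
so the isomorphism carries the given clique to the named one.\<close>

lemma degree_2_split:
  assumes "simple_graph X" "active X" "switch_degree X = 2" "split_bipartition X K I"
  shows "(\<exists>f. iso_map f X (graph_of D21) \<and> f ` K = clique D21) \<or>
     (\<exists>f. iso_map f X (graph_of (complement_split D21)) \<and> f ` K = clique (complement_split D21)) \<or>
     decomposable X"
proof (cases "decomposable X")
  case False
  note co = simple_complement[OF assms(1)]
  note split_co = split_bipartition_complement[OF assms(4)]
  show ?thesis
  proof (rule classify_degree_2[OF assms(1-3) False])
    fix p q r s assume te: "two_edges X p q r s" "verts X = {p, q, r, s}"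
    show ?thesis using two_edges_not_split[OF te(1) assms(4) te(2)] ..
  next
    fix p q r s assume te: "two_edges (complement X) p q r s" "verts X = {p, q, r, s}"
    show ?thesis using two_edges_not_split[OF te(1) split_co] te(2) by simp
  next
    fix a b k l m assume D: "d21 X a b k l m" "verts X = {a, b, k, l, m}"
    show ?thesis
      using d21_iso[OF assms(1) D] d21_split_unique(1)[OF D(1) assms(4) D(2)] by metis
  next
    fix a b k l m assume D: "d21 (complement X) a b k l m" "verts X = {a, b, k, l, m}"
    have V: "verts (complement X) = {a, b, k, l, m}" using D(2) by simp
    obtain f where f: "iso_map f (complement X) (graph_of D21)" "f ` {a, b} = indep D21"
      using d21_iso[OF co D(1) V] by metis
    have "K = {a, b}"
      using d21_split_unique(2)[OF D(1) split_co V] .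
    then have "iso_map f X (graph_of (complement_split D21))" "f ` K = clique (complement_split D21)"
      using iso_map_complement[OF assms(1) simple_named(1) f(1)] f(2) by (simp_all add: complement_split_def)
    then show ?thesis by blast
  qed
qed simp

text \<open>The degrees of the factors are one and two in some order. If the left factor has degree two and is
decomposable, regrouping makes its first \<open>P\<^sub>4\<close> the left factor, and the other order applies.\<close>

theorem decomposable_degree_3:
  assumes "simple_graph G" "active G" "switch_degree G = 3" "decomposable G"
  shows "G \<cong> P4 \<odot> graph_of D21 \<or> G \<cong> D21 \<odot> graph_of P4 \<or>
     G \<cong> P4 \<odot> complement (graph_of D21) \<or> G \<cong> complement_split D21 \<odot> graph_of P4 \<or>
     G \<cong> P4 \<odot> P4 \<odot> graph_of P4 \<or> G \<cong> P4 \<odot> C4 \<or> G \<cong> P4 \<odot> two_K2"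
proof -
  have P4_first: ?thesis
    if dec: "decomposition G K I M" and deg: "switch_degree (induced G (K \<union> I)) = 1" for K I M
  proof -
    note parts = decomposition_parts[OF assms(1,2) dec]
    have deg2: "switch_degree (induced G M) = 2"
      using parts(5) deg assms(3) by linarith
    obtain f where f: "iso_map f (induced G (K \<union> I)) (graph_of P4)" "f ` K = clique P4"
      using degree_1_split(1)[OF parts(1,3) deg decomposition_split[OF dec]] by blast
    show ?thesis
      using degree_2_iso[OF parts(2,4) deg2] compose_iso[OF dec f] by metis
  qed
  obtain K I M where dec: "decomposition G K I M"
    using assms(4) decomposable_iff_decomposition[OF assms(1)] by blast
  note parts = decomposition_parts[OF assms(1,2) dec]
  let ?S = "induced G (K \<union> I)"
  note split = decomposition_split[OF dec]
  consider "switch_degree ?S = 1" | "switch_degree ?S = 2" "switch_degree (induced G M) = 1"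
    using parts(5-7) assms(3) by linarith
  then show ?thesis
  proof cases
    case 1
    then show ?thesis using P4_first[OF dec] by blast
  next
    case 2
    note iso_M = degree_1_iso[OF parts(2,4) 2(2)]
    show ?thesis
    proof (cases "decomposable ?S")
      case False
      then show ?thesis
        using degree_2_split[OF parts(1,3) 2(1) split] compose_iso[OF dec _ _ iso_M] by blast
    next
      case True
      then obtain K' I' M' where dec': "decomposition ?S K' I' M'"
        using decomposable_iff_decomposition[OF parts(1)] by blast
      note parts' = decomposition_parts[OF parts(1,3) dec']
      have sub: "K' \<union> I' \<subseteq> K \<union> I"
        using dec' by (auto simp: decomposition_def)
      have deg': "switch_degree (induced ?S (K' \<union> I')) = 1"
        using parts'(5-7) 2(1) by linarith
      have "split_bipartition (induced ?S (K' \<union> I')) (K \<inter> (K' \<union> I')) (I \<inter> (K' \<union> I'))"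
        using split_bipartition_induced[OF split] sub by simp
      then have "K' = K \<inter> (K' \<union> I') \<and> I' = I \<inter> (K' \<union> I')"
        using degree_1_split(2)[OF parts'(1,3) deg' _ decomposition_split[OF dec']] by blast
      then have "decomposition G K' I' (M' \<union> M)"
        using decomposition_assoc[OF dec dec'] by blast
      then show ?thesis
        using P4_first deg' induced_induced[OF sub, of G] by simp
    qed
  qed
qed

theorem indecomposable_degree_3:
  assumes "simple_graph G" "active G" "switch_degree G = 3" "\<not> decomposable G"
  shows "\<exists>H \<in> {graph_of T111, complement (graph_of T111), graph_of D31, complement (graph_of D31),
                  graph_of T221, complement (graph_of T221)}. G \<cong> H"
proof -
  obtain X where X: "X = G \<or> X = complement G"
    "(\<exists>a b c k l m. t111 X a b c k l m) \<or> (\<exists>a b k l m n. d31 X a b k l m n) \<or>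
     (\<exists>a b c k l m. t221 X a b c k l m)"
    using classify_degree_3[OF assms] .
  have simple: "simple_graph X" "active X" "switch_degree X = 3"
    using X(1) assms(1-3) simple_complement active_complement switch_degree_complement by metis+
  have "(\<exists>f. iso_map f X (graph_of T111)) \<or> (\<exists>f. iso_map f X (graph_of D31)) \<or>
      (\<exists>f. iso_map f X (graph_of T221))"
    using X(2) t111_iso[OF simple(1) _ t111_exhausts[OF simple]] d31_iso[OF simple(1) _ d31_exhausts[OF simple]]
      t221_iso[OF simple(1) _ t221_exhausts[OF simple]] by metis
  then obtain H f where H: "H \<in> {graph_of T111, graph_of D31, graph_of T221}" "iso_map f X H"
    by blast
  have simple_H: "simple_graph H"
    using H(1) simple_named by blast
  have "G \<cong> H \<or> G \<cong> complement H"
    using X(1) H(2) iso_map_complement[OF assms(1) simple_H] unfolding graph_iso_iff by blast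
  then show ?thesis
    using H(1) by blast
qed

theorem theorem4p2:
  fixes G :: "'a graph"
  assumes "simple_graph G" and "active G" and "switch_degree G = 3"
  shows "(decomposable G \<longrightarrow>
            G \<cong> P4 \<odot> graph_of D21 \<or>
            G \<cong> D21 \<odot> graph_of P4 \<or>
            G \<cong> P4 \<odot> complement (graph_of D21) \<or>
            G \<cong> complement_split D21 \<odot> graph_of P4 \<or>
            G \<cong> P4 \<odot> P4 \<odot> graph_of P4 \<or>
            G \<cong> P4 \<odot> C4 \<or>
            G \<cong> P4 \<odot> two_K2)
       \<and> (\<not> decomposable G \<longrightarrow>
            (\<exists>H \<in> {graph_of T111, complement (graph_of T111),
                  graph_of D31, complement (graph_of D31),
                  graph_of T221, complement (graph_of T221)}. G \<cong> H))
       \<and> (\<forall>H \<in> {graph_of T111, complement (graph_of T111),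
                graph_of D31, complement (graph_of D31),
                graph_of T221, complement (graph_of T221)}. is_split H)"
proof (intro conjI impI)
  have "is_split (graph_of T111)" "is_split (graph_of D31)" "is_split (graph_of T221)"
    unfolding T111_def D31_def T221_def by (rule is_split_split_from)+
  then show "\<forall>H \<in> {graph_of T111, complement (graph_of T111), graph_of D31, complement (graph_of D31),
      graph_of T221, complement (graph_of T221)}. is_split H"
    using is_split_complement by blast
qed (use decomposable_degree_3[OF assms] indecomposable_degree_3[OF assms] in blast)+

end
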